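(* Let $g,h\in\mathcal{G}$. The following statements are equivalent: (a) if $K\subseteq V[g(n)]$ is bounded in $V[g(n)]$ and relatively compact in the supremum norm $\|\cdot\|_\infty$, then $K\subseteq V[h(n)]$ and $K$ is relatively compact in the space $V[h(n)]$; (b) $g(n)=o(h(n))$, i.e. $\lim_{n\to\infty}\frac{g(n)}{h(n)}=0$; (c) $\mathrm{Exh}(\phi_{g^M})\subseteq\mathrm{Exh}(\phi_h)$ for some increasing sequence $M=(m_k)_{k\in\mathbb{N}}$ of natural numbers.
   Context: $\mathbb{N}=\{1,2,\ldots\}$ and $I=[0,1]$. $\mathcal{G}$ is the set of all functions $g\colon\mathbb{N}\to[0,\infty)$, with $g(n)>0$ for all $n$, such that: $(g(n))_n$ is nondecreasing; $\lim_n g(n)=\infty$; $(n/g(n))_n$ is nondecreasing; and $\lim_n n/g(n)=+\infty$. For a nondecreasing $g\colon\mathbb{N}\to(0,\infty)$ with $g(n)\to\infty$ define $\phi_g\colon\mathcal{P}(\mathbb{N})\to[0,\infty]$ by $\phi_g(C)=\sup_{n\in\mathbb{N}}\frac{|C\cap\{1,\ldots,n\}|}{g(n)}$, and $\mathrm{Exh}(\phi_g)=\{C\subseteq\mathbb{N}:\lim_{n\to\infty}\phi_g(C\setminus\{1,\ldots,n\})=0\}$. For $g\in\mathcal{G}$ and an increasing sequence $M=(m_k)_{k\in\mathbb{N}}$ of natural numbers, $g^M\colon\mathbb{N}\to[0,\infty)$ is defined by $g^M(n)=k\,g(n)$, where $k$ is given by $m_k\leq n<m_{k+1}$, and $g^M(n)=g(n)$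 for $n<m_1$. For $x\colon I\to\mathbb{R}$ and a closed interval $J=[s,t]\subseteq I$ put $|x(J)|=|x(t)-x(s)|$. The modulus of variation of a bounded $x\colon I\to\mathbb{R}$ is $v(x,n)=\sup\sum_{k=1}^n|x(I_k)|$, the supremum over all $n$-element sequences $(I_1,\ldots,I_n)$ of nonoverlapping closed subintervals of $I$. The Chanturia class $V[g(n)]$ is the set of those $x\colon I\to\mathbb{R}$ for which there is $\eta>0$ with $v(x,n)\leq\eta g(n)$ for all $n\in\mathbb{N}$. The norm on $V[g(n)]$ is defined as follows. Let $\mathcal{M}_{\phi_g}$ be the family of all measures $\mu$ on $\mathbb{N}$ with $\mu(C)\leq\phi_g(C)$ for all $C\subseteq\mathbb{N}$, and for $y=(y_n)\in\mathbb{R}^{\mathbb{N}}$ let $\hat\phi_g(y)=\sup\{\sum_{n\in\mathbb{N}}\mu(\{n\})|y_n|:\mu\in\mathcal{M}_{\phi_g}\}$. Let $\mathcal{P}_I$ be the set of all infinite sequences $J=(J_n)_{n\in\mathbb{N}}$ of nonoverlapping closed (possibly degenerate) subintervals of $I$, and write $x(J)=(|x(J_n)|)_{n\in\mathbb{N}}$. It is known that for $g\in\mathcal{G}$ the class $V[g(n)]$ coincides with $\mathrm{BV}(\phi_g)$, the set of bounded $x\colon I\to\mathbb{R}$ with $\sup_{J\in\mathcal{P}_I}\hat\phi_g(x(J))<\infty$, which is a Banach space under the norm $\|x\|_{\phi_g}=|x(0)|+\sup_{J\in\mathcal{P}_I}\hat\phi_g(x(J))$. Boundedness and relative compactness in $V[g(n)]$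 (and in $V[h(n)]$) refer to this norm. Relatively compact in the supremum norm means relatively compact in the Banach space of all bounded functions $I\to\mathbb{R}$ with $\|x\|_\infty=\sup_{t\in I}|x(t)|$. *)

theory Defs
  imports "HOL-Analysis.Analysis"
begin

text \<open>
  The positive integers are the set \<open>{1..}\<close> of naturals: functions on them are functions on
  \<open>nat\<close> whose value at \<open>0\<close> is never used, subsets of them are sets \<open>C \<subseteq> {1..}\<close>. Functions on
  the unit interval are the elements of \<open>extensional {0..1}\<close>, so that two of them are equal as soon
  as they agree on \<open>{0..1}\<close>.
\<close>

definition growth_funs :: "(nat \<Rightarrow> real) set" where
  "growth_funs = {g. (\<forall>n\<ge>1. g n > 0) \<and>
     mono_on {1..} g \<and> filterlim g at_top sequentially \<and>
     mono_on {1..} (\<lambda>n. real n / g n) \<and> filterlim (\<lambda>n. real n / g n) at_top sequentially}"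

definition phi :: "(nat \<Rightarrow> real) \<Rightarrow> nat set \<Rightarrow> ennreal" where
  "phi g C = (SUP n\<in>{1..}. ennreal (real (card (C \<inter> {1..n})) / g n))"

definition Exh :: "(nat set \<Rightarrow> ennreal) \<Rightarrow> nat set set" where
  "Exh \<phi> = {C. C \<subseteq> {1..} \<and> (\<lambda>n. \<phi> (C - {1..n})) \<longlonglongrightarrow> 0}"

definition increasing_seq :: "(nat \<Rightarrow> nat) \<Rightarrow> bool" where
  "increasing_seq m \<longleftrightarrow> m ` {1..} \<subseteq> {1..} \<and> strict_mono_on {1..} m"

definition stretched :: "(nat \<Rightarrow> real) \<Rightarrow> (nat \<Rightarrow> nat) \<Rightarrow> nat \<Rightarrow> real" where
  "stretched g m n =
     (if n < m 1 then g n else real (THE k. 1 \<le> k \<and> m k \<le> n \<and> n < m (k + 1)) * g n)"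

text \<open>The closed interval \<open>{s..t}\<close>, possibly degenerate, is represented by the pair \<open>(s, t)\<close>.\<close>

definition unit_subintervals :: "(real \<times> real) set" where
  "unit_subintervals = {(s, t). 0 \<le> s \<and> s \<le> t \<and> t \<le> 1}"

definition incr :: "(real \<Rightarrow> real) \<Rightarrow> real \<times> real \<Rightarrow> real" where
  "incr x = (\<lambda>(s, t). \<bar>x t - x s\<bar>)"

definition nonoverlapping :: "nat set \<Rightarrow> (nat \<Rightarrow> real \<times> real) \<Rightarrow> bool" where
  "nonoverlapping A J \<longleftrightarrow>
     pairwise (\<lambda>i j. disjnt (interior {fst (J i)..snd (J i)}) (interior {fst (J j)..snd (J j)})) A"

definition interval_seqs :: "nat set \<Rightarrow> (nat \<Rightarrow> real \<times> real) set" where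
  "interval_seqs A = {J. J ` A \<subseteq> unit_subintervals \<and> nonoverlapping A J}"

text \<open>
  The modulus of variation is taken in \<open>[0, \<infinity>]\<close>. It is infinite for unbounded functions, so these
  do not belong to any Chanturia class.
\<close>

definition modulus_of_variation :: "(real \<Rightarrow> real) \<Rightarrow> nat \<Rightarrow> ennreal" where
  "modulus_of_variation x n =
     (SUP J\<in>interval_seqs {1..n}. \<Sum>k=1..n. ennreal (incr x (J k)))"

definition chanturia :: "(nat \<Rightarrow> real) \<Rightarrow> (real \<Rightarrow> real) set" where
  "chanturia g = {x \<in> extensional {0..1}.
     \<exists>\<eta>>0. \<forall>n\<ge>1. modulus_of_variation x n \<le> ennreal (\<eta> * g n)}"

definition dominated_measures :: "(nat set \<Rightarrow> ennreal) \<Rightarrow> nat measure set" where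
  "dominated_measures \<phi> =
     {\<mu>. space \<mu> = {1..} \<and> sets \<mu> = Pow {1..} \<and> (\<forall>C\<subseteq>{1..}. emeasure \<mu> C \<le> \<phi> C)}"

definition phi_hat :: "(nat set \<Rightarrow> ennreal) \<Rightarrow> (nat \<Rightarrow> real) \<Rightarrow> ennreal" where
  "phi_hat \<phi> y =
     (SUP \<mu>\<in>dominated_measures \<phi>. \<Sum>\<^sub>\<infinity>n\<in>{1..}. emeasure \<mu> {n} * ennreal \<bar>y n\<bar>)"

text \<open>
  The supremum is finite for \<open>x\<close> in \<open>chanturia g\<close> and \<open>\<phi> = phi g\<close> with \<open>g\<close> in
  \<open>growth_funs\<close>; the norm is only used there.
\<close>

definition phi_norm :: "(nat set \<Rightarrow> ennreal) \<Rightarrow> (real \<Rightarrow> real) \<Rightarrow> real" where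
  "phi_norm \<phi> x =
     \<bar>x 0\<bar> + enn2real (SUP J\<in>interval_seqs {1..}. phi_hat \<phi> (\<lambda>n. incr x (J n)))"

definition bounded_funs :: "(real \<Rightarrow> real) set" where
  "bounded_funs = {x \<in> extensional {0..1}. bounded (x ` {0..1})}"

definition sup_norm :: "(real \<Rightarrow> real) \<Rightarrow> real" where
  "sup_norm x = (SUP t\<in>{0..1}. \<bar>x t\<bar>)"

text \<open>
  The metric of a norm \<open>N\<close> on a space \<open>V\<close> of functions on \<open>{0..1}\<close>. Setting it to \<open>0\<close> outside
  \<open>V\<close> makes it nonnegative everywhere, as the locale \<^locale>\<open>Metric_space\<close> requires.
\<close>

definition norm_dist ::
    "(real \<Rightarrow> real) set \<Rightarrow> ((real \<Rightarrow> real) \<Rightarrow> real) \<Rightarrow> (real \<Rightarrow> real) \<Rightarrow> (real \<Rightarrow> real) \<Rightarrow> real" where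
  "norm_dist V N x y = (if x \<in> V \<and> y \<in> V then N (\<lambda>t\<in>{0..1}. x t - y t) else 0)"

definition norm_topology ::
    "(real \<Rightarrow> real) set \<Rightarrow> ((real \<Rightarrow> real) \<Rightarrow> real) \<Rightarrow> (real \<Rightarrow> real) topology" where
  "norm_topology V N = Metric_space.mtopology V (norm_dist V N)"

definition relatively_compact_in :: "'a topology \<Rightarrow> 'a set \<Rightarrow> bool" where
  "relatively_compact_in X K \<longleftrightarrow> K \<subseteq> topspace X \<and> compactin X (X closure_of K)"

end

theory Submission
  imports Defs
begin

text \<open>
  Up to a factor \<open>2\<close>, the norm of \<open>V[g(n)]\<close> is \<open>\<bar>x 0\<bar> + sup\<^sub>n v(x, n) / g(n)\<close>. The lower bound comes
  from the measures \<open>g(n)\<inverse>\<close> times counting on \<open>{1..n}\<close>. For the upper bound, a sequence \<open>y\<close> with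
  \<open>y\<^sub>1 + \<dots> + y\<^sub>n \<le> c g(n)\<close> and \<open>y\<^sub>k \<le> c g(1)\<close> is, after division by \<open>c g(1)\<close>, an average of
  indicators of sets \<open>C\<close> obtained by systematic sampling, so that
  \<open>\<bar>C \<inter> {1..n}\<bar> \<le> (y\<^sub>1 + \<dots> + y\<^sub>n) / (c g(1)) + 1 \<le> 2 g(n) / g(1)\<close>, that is, \<open>\<phi>\<^sub>g(C) \<le> 2 / g(1)\<close>.

  Hence if \<open>g = o(h)\<close>, then on sets bounded in \<open>V[g(n)]\<close> uniform convergence implies convergence in
  \<open>V[h(n)]\<close>: \<open>v(x, n)\<close> is at most \<open>2 n \<parallel>x\<parallel>\<close> for small \<open>n\<close> and at most \<open>B g(n)\<close> for large \<open>n\<close>. If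
  \<open>g(n) \<ge> \<epsilon> h(n)\<close> for infinitely many \<open>n\<close>, then for these \<open>n\<close> the functions \<open>g(n)/n cos(\<pi> n t)\<close> are
  bounded in \<open>V[g(n)]\<close> and tend to \<open>0\<close> uniformly, but stay away from \<open>0\<close> in \<open>V[h(n)]\<close>.
  The equivalence with the inclusion of ideals rests on \<open>C \<in> Exh(\<phi>\<^sub>f) \<longleftrightarrow> \<bar>C \<inter> {1..n}\<bar> / f(n) \<longlongrightarrow> 0\<close>
  and on a set whose counting function is \<open>\<lfloor>g(n) / g(1)\<rfloor>\<close>.
\<close>

section \<open>Systematic sampling and sums against a dominated mass function\<close>

text \<open>Hermite's identity for integers. Passing from \<open>T\<close> to \<open>Suc T\<close>
  drops the term \<open>T div N\<close> and adds \<open>(T + N) div N\<close>, which is larger by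
  one. It shows that the sample counts over all \<open>N\<close> offsets add up to the running
  total.\<close>

lemma sum_add_div:
  fixes T N :: nat
  assumes "N > 0"
  shows "(\<Sum>i<N. (T + i) div N) = T"
proof (induction T)
  case 0
  then show ?case by simp
next
  case (Suc T)
  have "(\<Sum>i<N. (Suc T + i) div N) + T div N = (\<Sum>i<Suc N. (T + i) div N)"
    by (subst sum.lessThan_Suc_shift) simp
  also have "\<dots> = T + (T div N + 1)"
    using Suc assms by simp
  finally show ?case by simp
qed

text \<open>
  Sampling every \<open>N\<close>-th unit of the running total of \<open>t\<close>, with starting offset \<open>i < N\<close>, picks each \<open>k\<close>
  for exactly \<open>t k\<close> of the \<open>N\<close> offsets.
\<close>

lemma systematic_sampling:
  fixes m f :: "nat \<Rightarrow> real" and t :: "nat \<Rightarrow> nat"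
  assumes N: "N > 0" and t: "\<And>k. t k \<le> N"
    and T: "\<And>n. n \<ge> 1 \<Longrightarrow> real (\<Sum>k=1..n. t k) / N + 1 \<le> r * f n"
    and dom: "\<And>C. C \<subseteq> {1..M} \<Longrightarrow> (\<And>n. n \<ge> 1 \<Longrightarrow> real (card (C \<inter> {1..n})) \<le> r * f n) \<Longrightarrow> sum m C \<le> r"
  shows "(\<Sum>k=1..M. m k * t k) \<le> N * r"
proof -
  define S where "S n = (\<Sum>k=1..n. t k)" for n
  \<comment> \<open>\<open>F i k\<close> is the number of positive multiples of \<open>N\<close> up
    to \<open>S k + i\<close>; \<open>k\<close> is sampled when the shifted running total passes
    such a multiple. As \<open>t k \<le> N\<close>, at most one is passed at each step.\<close>
  define F where "F i k = (S k + i) div N" for i k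
  define C where "C i = {k\<in>{1..M}. F i (k - 1) < F i k}" for i
  have C_sub: "C i \<subseteq> {1..M}" for i
    by (auto simp: C_def)
  have S_Suc: "S k = S (k - 1) + t k" if "k \<ge> 1" for k
    using that by (cases k) (auto simp: S_def)
  have F_step: "F i k = F i (k - 1) + of_bool (k \<in> C i)" if "k \<in> {1..M}" for i k
  proof -
    have "F i (k - 1) \<le> F i k"
      using that by (auto simp: F_def S_Suc intro!: div_le_mono)
    moreover have "F i k \<le> (S (k - 1) + i + N) div N"
      using that t[of k] by (auto simp: F_def S_Suc[of k] intro!: div_le_mono)
    then have "F i k \<le> F i (k - 1) + 1"
      using N by (simp add: F_def)
    ultimately show ?thesis
      using that by (auto simp: C_def)
  qed
  have F_sum: "F i n = i div N + (\<Sum>k=1..n. of_bool (k \<in> C i))" if "n \<le> M" for i n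
    using that
  proof (induction n)
    case 0
    then show ?case by (simp add: F_def S_def)
  next
    case (Suc n)
    then show ?case using F_step[of "Suc n" i] by simp
  qed
  have card_C: "real (card (C i \<inter> {1..n})) \<le> r * f n" if "n \<ge> 1" "i < N" for i n
  proof -
    define n' where "n' = min n M"
    have CI: "C i \<inter> {1..n} = {1..n'} \<inter> C i"
      by (auto simp: C_def n'_def)
    have "card (C i \<inter> {1..n}) = (\<Sum>k=1..n'. of_bool (k \<in> C i))"
      unfolding CI by simp
    also have "\<dots> = F i n'"
      using F_sum[of n' i] that by (simp add: n'_def)
    \<comment> \<open>Bounding the offset by \<open>N\<close> costs one extra sample; this is the
      \<open>+ 1\<close> in the hypothesis \<open>T\<close>.\<close>
    also have "\<dots> \<le> (S n + N) div N"
      unfolding F_def using that(2)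
      by (intro div_le_mono add_mono) (auto simp: S_def n'_def intro!: sum_mono2)
    also have "\<dots> = S n div N + 1"
      using N by simp
    finally have "real (card (C i \<inter> {1..n})) \<le> real (S n div N) + 1"
      by linarith
    also have "\<dots> \<le> real (S n) / N + 1"
      using of_nat_mono[OF div_times_less_eq_dividend[of "S n" N], where ?'a = real] N
      by (simp add: field_simps)
    also have "\<dots> \<le> r * f n"
      using T[OF that(1)] by (simp add: S_def)
    finally show ?thesis .
  qed
  \<comment> \<open>Summed over the offsets, \<open>F i k\<close> gives \<open>S k\<close> by
    Hermite's identity, so the increments at \<open>k\<close> sum to
    \<open>S k - S (k - 1) = t k\<close>.\<close>
  have t_eq: "real (t k) = (\<Sum>i<N. of_bool (k \<in> C i))" if "k \<in> {1..M}" for k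
  proof -
    have "(\<Sum>i<N. F i k) = (\<Sum>i<N. F i (k - 1)) + (\<Sum>i<N. of_bool (k \<in> C i))"
      using F_step[OF that] by (simp add: sum.distrib)
    then have "S k = S (k - 1) + (\<Sum>i<N. of_bool (k \<in> C i))"
      unfolding F_def using sum_add_div[OF N] by simp
    then have "t k = (\<Sum>i<N. of_bool (k \<in> C i))"
      using S_Suc[of k] that by simp
    then show ?thesis by simp
  qed
  have "(\<Sum>k=1..M. m k * t k) = (\<Sum>k=1..M. \<Sum>i<N. m k * of_bool (k \<in> C i))"
    by (intro sum.cong refl) (simp only: t_eq sum_distrib_left)
  also have "\<dots> = (\<Sum>i<N. \<Sum>k=1..M. m k * of_bool (k \<in> C i))"
    by (rule sum.swap)
  also have "\<dots> = (\<Sum>i<N. sum m (C i))"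
    using C_sub by (intro sum.cong refl sum.mono_neutral_cong_right) auto
  also have "\<dots> \<le> (\<Sum>i<N. r)"
    using card_C by (intro sum_mono dom) (auto simp: C_def)
  finally show ?thesis by simp
qed

text \<open>Dividing \<open>y\<close> by \<open>\<eta> * f 1\<close> gives weights \<open>p\<close>
  in the unit interval. Rounding \<open>N * p k\<close> down to integers makes systematic sampling
  applicable, the rounding costs \<open>sum m / N\<close>, and \<open>N\<close> tends to infinity.
  The factor 2 arises from \<open>f n / f 1 + 1 \<le> 2 * (f n / f 1)\<close>.\<close>

lemma dominated_sum_le:
  fixes m f y :: "nat \<Rightarrow> real"
  assumes f1: "f 1 > 0" and f_mono: "\<And>n. n \<ge> 1 \<Longrightarrow> f 1 \<le> f n"
    and m: "\<And>k. m k \<ge> 0" and y: "\<And>k. y k \<ge> 0"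
    and eta: "\<eta> > 0" and y_le: "\<And>k. y k \<le> \<eta> * f 1"
    and sum_le: "\<And>n. n \<ge> 1 \<Longrightarrow> (\<Sum>k=1..n. y k) \<le> \<eta> * f n"
    and dom: "\<And>C r. C \<subseteq> {1..M} \<Longrightarrow> r \<ge> 0 \<Longrightarrow>
                (\<And>n. n \<ge> 1 \<Longrightarrow> real (card (C \<inter> {1..n})) \<le> r * f n) \<Longrightarrow> sum m C \<le> r"
  shows "(\<Sum>k=1..M. m k * y k) \<le> 2 * \<eta>"
proof -
  define p where "p k = y k / (\<eta> * f 1)" for k
  have p: "0 \<le> p k" "p k \<le> 1" for k
    using f1 eta y y_le by (auto simp: p_def)
  have p_sum: "(\<Sum>k=1..n. p k) \<le> f n / f 1" if "n \<ge> 1" for n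
  proof -
    have "(\<Sum>k=1..n. p k) = (\<Sum>k=1..n. y k) / (\<eta> * f 1)"
      unfolding p_def by (simp add: sum_divide_distrib)
    also have "\<dots> \<le> (\<eta> * f n) / (\<eta> * f 1)"
      using sum_le[OF that] eta f1 by (intro divide_right_mono) auto
    finally show ?thesis using eta by simp
  qed
  have *: "(\<Sum>k=1..M. m k * p k) \<le> 2 / f 1 + (\<Sum>k=1..M. m k) * inverse (real N)" if "N \<ge> 1" for N
  proof -
    define t where "t k = nat \<lfloor>real N * p k\<rfloor>" for k
    have t_le: "real (t k) \<le> N * p k" and t_ge: "N * p k - 1 \<le> t k" for k
      using p[of k] by (auto simp: t_def)
    have "(\<Sum>k=1..M. m k * t k) \<le> N * (2 / f 1)"
    proof (rule systematic_sampling)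
      show "N > 0" using that by simp
      show "t k \<le> N" for k
        using t_le[of k] p[of k] mult_left_le[of "p k" "real N"] by linarith
      show "real (\<Sum>k=1..n. t k) / N + 1 \<le> 2 / f 1 * f n" if "n \<ge> 1" for n
      proof -
        have "real (\<Sum>k=1..n. t k) \<le> (\<Sum>k=1..n. N * p k)"
          unfolding of_nat_sum by (intro sum_mono t_le)
        also have "\<dots> = N * (\<Sum>k=1..n. p k)"
          by (simp add: sum_distrib_left)
        also have "\<dots> \<le> N * (f n / f 1)"
          by (intro mult_left_mono p_sum that) auto
        finally have "real (\<Sum>k=1..n. t k) / N \<le> f n / f 1"
          using \<open>N \<ge> 1\<close> by (simp add: field_simps)
        moreover have "1 \<le> f n / f 1"
          using f1 f_mono[OF that] by simp
        ultimately show ?thesis by simp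
      qed
    qed (use dom f1 in auto)
    moreover have "(\<Sum>k=1..M. m k * (N * p k - 1)) \<le> (\<Sum>k=1..M. m k * t k)"
      by (intro sum_mono mult_left_mono t_ge m)
    moreover have "(\<Sum>k=1..M. m k * (N * p k - 1)) = N * (\<Sum>k=1..M. m k * p k) - (\<Sum>k=1..M. m k)"
      by (simp add: algebra_simps sum_subtractf sum_distrib_left)
    ultimately have "N * (\<Sum>k=1..M. m k * p k) \<le> N * (2 / f 1) + (\<Sum>k=1..M. m k)"
      by linarith
    then show ?thesis
      using that by (simp add: field_simps)
  qed
  have "(\<lambda>N. 2 / f 1 + (\<Sum>k=1..M. m k) * inverse (real N)) \<longlonglongrightarrow> 2 / f 1 + (\<Sum>k=1..M. m k) * 0"
    by (intro tendsto_intros lim_inverse_n)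
  then have "(\<Sum>k=1..M. m k * p k) \<le> 2 / f 1"
    using * by (intro LIMSEQ_le_const) auto
  then have "(\<Sum>k=1..M. m k * p k) * (\<eta> * f 1) \<le> 2 / f 1 * (\<eta> * f 1)"
    using eta f1 by (intro mult_right_mono) auto
  then show ?thesis
    using eta f1 by (simp add: p_def sum_distrib_right)
qed

section \<open>Growth functions and bounds on the modulus of variation\<close>

lemma growth_funsD:
  assumes "g \<in> growth_funs"
  shows growth_pos: "\<And>n. n \<ge> 1 \<Longrightarrow> g n > 0"
    and growth_mono: "\<And>m n. 1 \<le> m \<Longrightarrow> m \<le> n \<Longrightarrow> g m \<le> g n"
    and growth_at_top: "filterlim g at_top sequentially"
    and growth_ratio_mono: "\<And>m n. 1 \<le> m \<Longrightarrow> m \<le> n \<Longrightarrow> real m / g m \<le> real n / g n"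
    and growth_ratio_at_top: "filterlim (\<lambda>n. real n / g n) at_top sequentially"
  using assms by (auto simp: growth_funs_def mono_on_def)

lemma phi_le_iff:
  assumes "\<forall>n\<ge>1. f n > 0" and "r \<ge> 0"
  shows "phi f C \<le> ennreal r \<longleftrightarrow> (\<forall>n\<ge>1. real (card (C \<inter> {1..n})) \<le> r * f n)"
proof -
  have "phi f C \<le> ennreal r \<longleftrightarrow> (\<forall>n\<ge>1. real (card (C \<inter> {1..n})) / f n \<le> r)"
    using assms by (auto simp: phi_def SUP_le_iff)
  also have "\<dots> \<longleftrightarrow> (\<forall>n\<ge>1. real (card (C \<inter> {1..n})) \<le> r * f n)"
    using assms(1) by (intro all_cong) (simp add: pos_divide_le_eq)
  finally show ?thesis .
qed

text \<open>The bound v(x, n) \<le> c g(n) in real numbers. All estimates are made in this form; the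
  Chanturia class and the norm are translated into it.\<close>

definition variation_le :: "(nat \<Rightarrow> real) \<Rightarrow> real \<Rightarrow> (real \<Rightarrow> real) \<Rightarrow> bool" where
  "variation_le g c x \<longleftrightarrow> (\<forall>n\<ge>1. \<forall>J\<in>interval_seqs {1..n}. (\<Sum>k=1..n. incr x (J k)) \<le> c * g n)"

lemma variation_leD:
  "variation_le g c x \<Longrightarrow> n \<ge> 1 \<Longrightarrow> J \<in> interval_seqs {1..n} \<Longrightarrow> (\<Sum>k=1..n. incr x (J k)) \<le> c * g n"
  by (auto simp: variation_le_def)

lemma incr_nonneg [simp]: "0 \<le> incr x p"
  by (auto simp: incr_def split: prod.splits)

lemma incr_diff_le:
  "p \<in> unit_subintervals \<Longrightarrow> incr (\<lambda>t\<in>{0..1}. x t - y t) p \<le> incr x p + incr y p"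
  by (auto simp: incr_def unit_subintervals_def)

lemma incr_diff_triangle:
  "p \<in> unit_subintervals \<Longrightarrow> incr (\<lambda>t\<in>{0..1}. x t - z t) p
     \<le> incr (\<lambda>t\<in>{0..1}. x t - y t) p + incr (\<lambda>t\<in>{0..1}. y t - z t) p"
  by (auto simp: incr_def unit_subintervals_def)

lemma incr_diff_commute:
  "p \<in> unit_subintervals \<Longrightarrow> incr (\<lambda>t\<in>{0..1}. x t - y t) p = incr (\<lambda>t\<in>{0..1}. y t - x t) p"
  by (auto simp: incr_def unit_subintervals_def)

lemma interval_seqs_mono: "A \<subseteq> B \<Longrightarrow> J \<in> interval_seqs B \<Longrightarrow> J \<in> interval_seqs A"
  unfolding interval_seqs_def nonoverlapping_def by (blast intro: pairwise_subset)

lemma interval_seqsD: "J \<in> interval_seqs A \<Longrightarrow> k \<in> A \<Longrightarrow> J k \<in> unit_subintervals"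
  by (auto simp: interval_seqs_def)

lemma const_interval_seq: "p \<in> unit_subintervals \<Longrightarrow> (\<lambda>_. p) \<in> interval_seqs {1..1}"
  by (auto simp: interval_seqs_def nonoverlapping_def)

lemma variation_le_incr:
  "variation_le g c x \<Longrightarrow> p \<in> unit_subintervals \<Longrightarrow> incr x p \<le> c * g 1"
  using variation_leD[of g c x 1 "\<lambda>_. p"] const_interval_seq by simp

lemma variation_le_diff:
  assumes "variation_le g a x" and "variation_le g b y"
  shows "variation_le g (a + b) (\<lambda>t\<in>{0..1}. x t - y t)"
  unfolding variation_le_def
proof (intro allI impI ballI)
  fix n :: nat and J assume n: "n \<ge> 1" and J: "J \<in> interval_seqs {1..n}"
  have "(\<Sum>k=1..n. incr (\<lambda>t\<in>{0..1}. x t - y t) (J k)) \<le> (\<Sum>k=1..n. incr x (J k) + incr y (J k))"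
    using interval_seqsD[OF J] by (intro sum_mono incr_diff_le) auto
  also have "\<dots> \<le> a * g n + b * g n"
    using variation_leD[OF assms(1) n J] variation_leD[OF assms(2) n J] by (simp add: sum.distrib)
  finally show "(\<Sum>k=1..n. incr (\<lambda>t\<in>{0..1}. x t - y t) (J k)) \<le> (a + b) * g n"
    by (simp add: algebra_simps)
qed

lemma variation_le_mono:
  assumes "variation_le g a x" and "\<And>n. n \<ge> 1 \<Longrightarrow> a * g n \<le> b * h n"
  shows "variation_le h b x"
  using assms unfolding variation_le_def by (meson order_trans)

lemma chanturia_iff:
  assumes "g \<in> growth_funs"
  shows "x \<in> chanturia g \<longleftrightarrow> x \<in> extensional {0..1} \<and> (\<exists>\<eta>>0. variation_le g \<eta> x)"
proof -
  have "modulus_of_variation x n \<le> ennreal (\<eta> * g n) \<longleftrightarrow>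
        (\<forall>J\<in>interval_seqs {1..n}. (\<Sum>k=1..n. incr x (J k)) \<le> \<eta> * g n)"
    if "n \<ge> 1" "\<eta> > 0" for n \<eta>
    using growth_pos[OF assms that(1)] that(2)
    by (auto simp: modulus_of_variation_def SUP_le_iff sum_ennreal)
  then show ?thesis
    unfolding chanturia_def variation_le_def by auto
qed

lemma chanturia_diff:
  assumes "g \<in> growth_funs" and "x \<in> chanturia g" and "y \<in> chanturia g"
  shows "(\<lambda>t\<in>{0..1}. x t - y t) \<in> chanturia g"
proof -
  obtain a b where "a > 0" "variation_le g a x" "b > 0" "variation_le g b y"
    using assms(2,3) unfolding chanturia_iff[OF assms(1)] by auto
  then show ?thesis
    unfolding chanturia_iff[OF assms(1)]
    by (intro conjI exI[of _ "a + b"] variation_le_diff) auto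
qed

section \<open>Comparison of the norm with bounds on the modulus of variation\<close>

text \<open>The seminorm part of the norm, kept in \<open>ennreal\<close>: \<open>enn2real\<close>
  sends infinity to 0, so finiteness has to be established before it is applied.\<close>

definition phi_var :: "(nat \<Rightarrow> real) \<Rightarrow> (real \<Rightarrow> real) \<Rightarrow> ennreal" where
  "phi_var g x = (SUP J\<in>interval_seqs {1..}. phi_hat (phi g) (\<lambda>n. incr x (J n)))"

lemma phi_norm_eq: "phi_norm (phi g) x = \<bar>x 0\<bar> + enn2real (phi_var g x)"
  by (simp add: phi_norm_def phi_var_def)

text \<open>A dominated measure has point masses \<open>m\<close> with
  \<open>sum m C \<le> r\<close> as soon as the counting function of \<open>C\<close> is at most
  \<open>r * g n\<close>. This is the domination that \<open>dominated_sum_le\<close> asks for, and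
  it bounds every finite partial sum.\<close>

lemma phi_hat_le:
  assumes g: "g \<in> growth_funs" and c: "c > 0" and y: "\<And>k. y k \<ge> 0" "\<And>k. y k \<le> c * g 1"
    and y_sum: "\<And>n. n \<ge> 1 \<Longrightarrow> (\<Sum>k=1..n. y k) \<le> c * g n"
  shows "phi_hat (phi g) y \<le> ennreal (2 * c)"
  unfolding phi_hat_def
proof (rule SUP_least)
  fix \<mu> assume "\<mu> \<in> dominated_measures (phi g)"
  then have sets: "sets \<mu> = Pow {1..}" and dom: "\<And>C. C \<subseteq> {1..} \<Longrightarrow> emeasure \<mu> C \<le> phi g C"
    by (auto simp: dominated_measures_def)
  note pos = growth_pos[OF g]
  then have pos': "\<forall>n\<ge>1. g n > 0" by simp
  define m where "m k = measure \<mu> {k}" for k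
  \<comment> \<open>Point masses are finite because \<open>phi g {k} \<le> 1 / g 1\<close>, so the
    real-valued \<open>m\<close> represents them.\<close>
  have m: "emeasure \<mu> {k} = ennreal (m k)" if "k \<in> {1..}" for k
  proof -
    have "card ({k} \<inter> {1..n}) \<le> 1" for n
      using card_mono[of "{k}" "{k} \<inter> {1..n}"] by auto
    moreover have "1 \<le> inverse (g 1) * g n" if "n \<ge> 1" for n
      using growth_mono[OF g, of 1 n] pos[of 1] that by (simp add: field_simps)
    ultimately have "phi g {k} \<le> ennreal (inverse (g 1))"
      using pos[of 1] by (subst phi_le_iff[OF pos']) (auto intro: order_trans[of _ 1])
    with dom[of "{k}"] that have "emeasure \<mu> {k} \<le> ennreal (inverse (g 1))" by auto
    then have "emeasure \<mu> {k} < \<infinity>" by (rule order_le_less_trans) simp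
    then show ?thesis by (simp add: m_def emeasure_eq_ennreal_measure)
  qed
  have sum_m: "sum m C \<le> r"
    if C: "C \<subseteq> {1..M}" and "r \<ge> 0" and r: "\<And>n. n \<ge> 1 \<Longrightarrow> real (card (C \<inter> {1..n})) \<le> r * g n" for C M r
  proof -
    have "finite C" "C \<subseteq> {1..}"
      using C finite_subset[OF C] by auto
    have "ennreal (sum m C) = (\<Sum>k\<in>C. ennreal (m k))"
      by (subst sum_ennreal) (auto simp: m_def)
    also have "\<dots> = (\<Sum>k\<in>C. emeasure \<mu> {k})"
      using m \<open>C \<subseteq> {1..}\<close> by (intro sum.cong) auto
    also have "\<dots> = emeasure \<mu> C"
      using \<open>finite C\<close> \<open>C \<subseteq> {1..}\<close> by (intro emeasure_eq_sum_singleton[symmetric]) (auto simp: sets)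
    also have "\<dots> \<le> ennreal r"
      using dom[OF \<open>C \<subseteq> {1..}\<close>] phi_le_iff[OF pos' \<open>r \<ge> 0\<close>] r by (meson order_trans)
    finally show ?thesis using \<open>r \<ge> 0\<close> by simp
  qed
  have fin: "(\<Sum>n\<in>F. emeasure \<mu> {n} * ennreal \<bar>y n\<bar>) \<le> ennreal (2 * c)" if F: "finite F" "F \<subseteq> {1..}" for F
  proof -
    obtain M where "F \<subseteq> {..M}" using finite_nat_iff_bounded_le F(1) by auto
    then have FM: "F \<subseteq> {1..M}" using F(2) by auto
    have "(\<Sum>n\<in>F. emeasure \<mu> {n} * ennreal \<bar>y n\<bar>) \<le> (\<Sum>n=1..M. emeasure \<mu> {n} * ennreal \<bar>y n\<bar>)"
      using FM by (intro sum_mono2) auto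
    also have "\<dots> = ennreal (\<Sum>n=1..M. m n * y n)"
      using m y by (subst sum_ennreal[symmetric]) (auto simp: ennreal_mult m_def intro!: sum.cong)
    also have "\<dots> \<le> ennreal (2 * c)"
      using pos[of 1] growth_mono[OF g, of 1] c y y_sum sum_m
      by (intro ennreal_leI dominated_sum_le[where f = g]) (auto simp: m_def)
    finally show ?thesis .
  qed
  show "(\<Sum>\<^sub>\<infinity>n\<in>{1..}. emeasure \<mu> {n} * ennreal \<bar>y n\<bar>) \<le> ennreal (2 * c)"
    by (intro infsum_le_finite_sums fin nonneg_summable_on_complete) auto
qed

lemma phi_var_le:
  assumes g: "g \<in> growth_funs" and c: "c > 0" and x: "variation_le g c x"
  shows "phi_var g x \<le> ennreal (2 * c)"
  unfolding phi_var_def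
proof (rule SUP_least)
  fix J assume J: "J \<in> interval_seqs {1..}"
  \<comment> \<open>\<open>J 0\<close> is unconstrained while \<open>phi_hat_le\<close> asks for
    bounds at every index, hence the value 0 at index 0.\<close>
  define y where "y k = (if k \<ge> 1 then incr x (J k) else 0)" for k
  have "phi_hat (phi g) y \<le> ennreal (2 * c)"
  proof (rule phi_hat_le[OF g c])
    show "y k \<le> c * g 1" for k
      using variation_le_incr[OF x, of "J k"] interval_seqsD[OF J, of k] c growth_pos[OF g, of 1]
      by (auto simp: y_def)
    show "(\<Sum>k=1..n. y k) \<le> c * g n" if "n \<ge> 1" for n
      using variation_leD[OF x that, of J] interval_seqs_mono[OF _ J, of "{1..n}"]
      by (auto simp: y_def)
  qed (auto simp: y_def)
  moreover have "phi_hat (phi g) y = phi_hat (phi g) (\<lambda>n. incr x (J n))"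
    unfolding phi_hat_def by (intro SUP_cong infsum_cong) (auto simp: y_def)
  ultimately show "phi_hat (phi g) (\<lambda>n. incr x (J n)) \<le> ennreal (2 * c)" by simp
qed

lemma phi_var_finite:
  assumes "g \<in> growth_funs" and "x \<in> chanturia g"
  shows "phi_var g x < top"
proof -
  obtain c where "c > 0" "variation_le g c x"
    using assms(2) chanturia_iff[OF assms(1)] by blast
  from phi_var_le[OF assms(1) this] show ?thesis
    using ennreal_less_top order_le_less_trans by blast
qed

lemma phi_norm_le:
  assumes "g \<in> growth_funs" and "c > 0" and "variation_le g c x"
  shows "phi_norm (phi g) x \<le> \<bar>x 0\<bar> + 2 * c"
  using enn2real_leI[OF _ phi_var_le[OF assms]] assms(2) by (simp add: phi_norm_eq)

text \<open>The test measure gives each point of \<open>{1..n}\<close> the mass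
  \<open>1 / g n\<close>. Its value on \<open>C\<close> is the \<open>n\<close>-th term of the
  supremum defining \<open>phi g C\<close>, so it is dominated.\<close>

lemma sum_le_phi_hat:
  assumes g: "g \<in> growth_funs" and n: "n \<ge> 1" and y: "\<And>k. y k \<ge> 0"
  shows "ennreal ((\<Sum>k=1..n. y k) / g n) \<le> phi_hat (phi g) y"
proof -
  define f :: "nat \<Rightarrow> ennreal" where "f k = ennreal (if k \<in> {1..n} then 1 / g n else 0)" for k
  define \<mu> where "\<mu> = point_measure {1..} f"
  have gn: "g n > 0" using growth_pos[OF g n] .
  have em: "emeasure \<mu> C = ennreal (real (card (C \<inter> {1..n})) / g n)" if "C \<subseteq> {1..}" for C
  proof -
    have eq: "{k \<in> C. 0 < f k} = C \<inter> {1..n}"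
      using gn by (auto simp: f_def)
    have "emeasure \<mu> C = (\<Sum>k\<in>C \<inter> {1..n}. f k)"
      unfolding \<mu>_def using that eq by (subst emeasure_point_measure) auto
    also have "\<dots> = (\<Sum>k\<in>C \<inter> {1..n}. ennreal (1 / g n))"
      by (intro sum.cong) (auto simp: f_def)
    also have "\<dots> = ennreal (real (card (C \<inter> {1..n})) / g n)"
      using gn by (subst sum_ennreal) (simp_all add: field_simps)
    finally show ?thesis .
  qed
  have "\<mu> \<in> dominated_measures (phi g)"
    unfolding dominated_measures_def
  proof (intro CollectI conjI allI impI)
    show "space \<mu> = {1..}" "sets \<mu> = Pow {1..}"
      by (auto simp: \<mu>_def space_point_measure sets_point_measure)
    show "emeasure \<mu> C \<le> phi g C" if "C \<subseteq> {1..}" for C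
      unfolding em[OF that] phi_def using n by (intro SUP_upper) auto
  qed
  then have "(\<Sum>\<^sub>\<infinity>k\<in>{1..}. emeasure \<mu> {k} * ennreal \<bar>y k\<bar>) \<le> phi_hat (phi g) y"
    unfolding phi_hat_def by (rule SUP_upper)
  moreover have "(\<Sum>k=1..n. emeasure \<mu> {k} * ennreal \<bar>y k\<bar>) \<le> (\<Sum>\<^sub>\<infinity>k\<in>{1..}. emeasure \<mu> {k} * ennreal \<bar>y k\<bar>)"
    by (subst nonneg_infsum_complete, simp) (rule SUP_upper, auto)
  moreover have "(\<Sum>k=1..n. emeasure \<mu> {k} * ennreal \<bar>y k\<bar>) = (\<Sum>k=1..n. ennreal (y k / g n))"
    using gn y by (intro sum.cong refl) (auto simp: em ennreal_mult[symmetric])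
  moreover have "\<dots> = ennreal ((\<Sum>k=1..n. y k) / g n)"
    using gn y by (subst sum_ennreal) (auto simp: sum_divide_distrib)
  ultimately show ?thesis by simp
qed

text \<open>The counterpart of \<open>phi_norm_le\<close>: together they make the norm and the best
  constant in \<open>variation_le\<close> interchangeable up to a factor 2 and the term
  \<open>\<bar>x 0\<bar>\<close>.\<close>

lemma variation_le_phi_norm:
  assumes g: "g \<in> growth_funs" and x: "x \<in> chanturia g" and B: "phi_norm (phi g) x \<le> B"
  shows "variation_le g B x"
  unfolding variation_le_def
proof (intro allI impI ballI)
  fix n :: nat and J assume n: "n \<ge> 1" and J: "J \<in> interval_seqs {1..n}"
  \<comment> \<open>A degenerate interval has empty interior, so padding with \<open>(0, 0)\<close>
    keeps the sequence nonoverlapping.\<close>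
  define J' where "J' k = (if k \<in> {1..n} then J k else (0, 0))" for k
  have J': "J' \<in> interval_seqs {1..}"
    unfolding interval_seqs_def nonoverlapping_def
  proof (intro CollectI conjI)
    have "(0, 0) \<in> unit_subintervals" by (simp add: unit_subintervals_def)
    then show "J' ` {1..} \<subseteq> unit_subintervals"
      using interval_seqsD[OF J] by (auto simp: J'_def)
    show "pairwise (\<lambda>i j. disjnt (interior {fst (J' i)..snd (J' i)}) (interior {fst (J' j)..snd (J' j)})) {1..}"
      using J unfolding interval_seqs_def nonoverlapping_def
      by (auto simp: J'_def pairwise_def disjnt_def)
  qed
  have gn: "g n > 0" using growth_pos[OF g n] .
  have "ennreal ((\<Sum>k=1..n. incr x (J k)) / g n) = ennreal ((\<Sum>k=1..n. incr x (J' k)) / g n)"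
    by (simp add: J'_def)
  also have "\<dots> \<le> phi_hat (phi g) (\<lambda>k. incr x (J' k))"
    by (rule sum_le_phi_hat[OF g n]) simp
  also have "\<dots> \<le> phi_var g x"
    unfolding phi_var_def using J' by (rule SUP_upper)
  \<comment> \<open>Membership in \<open>chanturia g\<close> enters here: it makes
    \<open>phi_var g x\<close> finite, so \<open>enn2real\<close> loses nothing.\<close>
  also have "\<dots> = ennreal (enn2real (phi_var g x))"
    using phi_var_finite[OF g x] by simp
  finally have "(\<Sum>k=1..n. incr x (J k)) / g n \<le> enn2real (phi_var g x)"
    by (rule ennreal_le_iff[OF enn2real_nonneg, THEN iffD1])
  also have "\<dots> \<le> B"
    using B by (simp add: phi_norm_eq)
  finally show "(\<Sum>k=1..n. incr x (J k)) \<le> B * g n"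
    using gn by (simp add: field_simps)
qed

section \<open>The metric of the Chanturia class\<close>

lemma phi_hat_triangle:
  assumes "\<And>k. k \<ge> 1 \<Longrightarrow> \<bar>y k\<bar> \<le> \<bar>a k\<bar> + \<bar>b k\<bar>"
  shows "phi_hat \<phi> y \<le> phi_hat \<phi> a + phi_hat \<phi> b"
  unfolding phi_hat_def
proof (rule SUP_least)
  fix \<mu> assume \<mu>: "\<mu> \<in> dominated_measures \<phi>"
  have "(\<Sum>\<^sub>\<infinity>n\<in>{1..}. emeasure \<mu> {n} * ennreal \<bar>y n\<bar>) \<le>
        (\<Sum>\<^sub>\<infinity>n\<in>{1..}. emeasure \<mu> {n} * ennreal \<bar>a n\<bar> + emeasure \<mu> {n} * ennreal \<bar>b n\<bar>)"
    using assms by (intro infsum_mono nonneg_summable_on_complete)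
      (auto simp: distrib_left[symmetric] ennreal_plus[symmetric] simp del: ennreal_plus
            intro!: mult_left_mono ennreal_leI)
  also have "\<dots> = (\<Sum>\<^sub>\<infinity>n\<in>{1..}. emeasure \<mu> {n} * ennreal \<bar>a n\<bar>) + (\<Sum>\<^sub>\<infinity>n\<in>{1..}. emeasure \<mu> {n} * ennreal \<bar>b n\<bar>)"
    by (intro infsum_add nonneg_summable_on_complete) auto
  finally show "(\<Sum>\<^sub>\<infinity>n\<in>{1..}. emeasure \<mu> {n} * ennreal \<bar>y n\<bar>) \<le>
      (SUP \<mu>\<in>dominated_measures \<phi>. \<Sum>\<^sub>\<infinity>n\<in>{1..}. emeasure \<mu> {n} * ennreal \<bar>a n\<bar>) +
      (SUP \<mu>\<in>dominated_measures \<phi>. \<Sum>\<^sub>\<infinity>n\<in>{1..}. emeasure \<mu> {n} * ennreal \<bar>b n\<bar>)"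
    using \<mu> by (elim order_trans) (intro add_mono SUP_upper)
qed

lemma phi_var_diff_triangle:
  "phi_var g (\<lambda>t\<in>{0..1}. x t - z t)
     \<le> phi_var g (\<lambda>t\<in>{0..1}. x t - y t) + phi_var g (\<lambda>t\<in>{0..1}. y t - z t)"
  unfolding phi_var_def
proof (rule SUP_least)
  fix J assume J: "J \<in> interval_seqs {1..}"
  have "phi_hat (phi g) (\<lambda>n. incr (\<lambda>t\<in>{0..1}. x t - z t) (J n)) \<le>
        phi_hat (phi g) (\<lambda>n. incr (\<lambda>t\<in>{0..1}. x t - y t) (J n)) +
        phi_hat (phi g) (\<lambda>n. incr (\<lambda>t\<in>{0..1}. y t - z t) (J n))"
    using interval_seqsD[OF J] incr_diff_triangle by (intro phi_hat_triangle) auto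
  then show "phi_hat (phi g) (\<lambda>n. incr (\<lambda>t\<in>{0..1}. x t - z t) (J n)) \<le>
      (SUP J\<in>interval_seqs {1..}. phi_hat (phi g) (\<lambda>n. incr (\<lambda>t\<in>{0..1}. x t - y t) (J n))) +
      (SUP J\<in>interval_seqs {1..}. phi_hat (phi g) (\<lambda>n. incr (\<lambda>t\<in>{0..1}. y t - z t) (J n)))"
    using J by (elim order_trans) (intro add_mono SUP_upper)
qed

lemma phi_var_diff_commute:
  "phi_var g (\<lambda>t\<in>{0..1}. x t - y t) = phi_var g (\<lambda>t\<in>{0..1}. y t - x t)"
  unfolding phi_var_def phi_hat_def
  by (intro SUP_cong infsum_cong) (auto simp: incr_diff_commute[OF interval_seqsD[of _ "{1..}"], of _ _ x y])

text \<open>The single interval from 0 to \<open>t\<close> already bounds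
  \<open>\<bar>x t - x 0\<bar>\<close>. Hence the norm is definite, and convergence in it implies
  pointwise convergence.\<close>

lemma abs_le_phi_norm:
  assumes g: "g \<in> growth_funs" and x: "x \<in> chanturia g" and t: "t \<in> {0..1}"
  shows "\<bar>x t\<bar> \<le> phi_norm (phi g) x * (1 + g 1)"
proof -
  have "incr x (0, t) \<le> phi_norm (phi g) x * g 1"
    using variation_le_incr[OF variation_le_phi_norm[OF g x order_refl]] t
    by (auto simp: unit_subintervals_def)
  moreover have "\<bar>x 0\<bar> \<le> phi_norm (phi g) x"
    by (simp add: phi_norm_eq)
  ultimately show ?thesis
    by (auto simp: incr_def algebra_simps)
qed

lemma phi_norm_nonneg: "0 \<le> phi_norm (phi g) x"
  by (simp add: phi_norm_eq)

lemma Metric_space_chanturia: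
  assumes g: "g \<in> growth_funs"
  shows "Metric_space (chanturia g) (norm_dist (chanturia g) (phi_norm (phi g)))"
proof
  note diff = chanturia_diff[OF g]
  fix x y z
  show "0 \<le> norm_dist (chanturia g) (phi_norm (phi g)) x y"
    by (simp add: norm_dist_def phi_norm_nonneg)
  show "norm_dist (chanturia g) (phi_norm (phi g)) x y = norm_dist (chanturia g) (phi_norm (phi g)) y x"
    by (auto simp: norm_dist_def phi_norm_eq phi_var_diff_commute[of g x y])
  assume x: "x \<in> chanturia g" and y: "y \<in> chanturia g"
  show "norm_dist (chanturia g) (phi_norm (phi g)) x y = 0 \<longleftrightarrow> x = y"
  proof
    assume "norm_dist (chanturia g) (phi_norm (phi g)) x y = 0"
    then have "x t = y t" if "t \<in> {0..1}" for t
      using abs_le_phi_norm[OF g diff[OF x y] that] x y that by (simp add: norm_dist_def)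
    moreover have "x \<in> extensional {0..1}" "y \<in> extensional {0..1}"
      using x y by (auto simp: chanturia_def)
    ultimately show "x = y" by (auto intro: extensionalityI)
  next
    assume "x = y"
    have "incr (\<lambda>t\<in>{0..1}. 0) p = 0" if "p \<in> unit_subintervals" for p
      using that by (auto simp: incr_def unit_subintervals_def)
    then have "(\<Sum>k=1..n. incr (\<lambda>t\<in>{0..1}. 0) (J k)) = 0" if "J \<in> interval_seqs {1..n}" for n J
      using interval_seqsD[OF that] by (intro sum.neutral) auto
    then have "variation_le g c (\<lambda>t\<in>{0..1}. 0)" if "c > 0" for c
      using growth_pos[OF g] that by (auto simp: variation_le_def less_imp_le)
    then have "phi_norm (phi g) (\<lambda>t\<in>{0..1}. 0) \<le> 2 * c" if "c > 0" for c
      using phi_norm_le[OF g, of c "\<lambda>t\<in>{0..1}. 0"] that by simp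
    \<comment> \<open>The bound \<open>2 * c\<close> is available only for positive
      \<open>c\<close>. If the norm were positive, a third of it as \<open>c\<close> would make it
      at most two thirds of itself.\<close>
    from this[of "phi_norm (phi g) (\<lambda>t\<in>{0..1}. 0) / 3"] have "phi_norm (phi g) (\<lambda>t\<in>{0..1}. 0) = 0"
      using phi_norm_nonneg[of g "\<lambda>t\<in>{0..1}. 0"] by argo
    then show "norm_dist (chanturia g) (phi_norm (phi g)) x y = 0"
      using \<open>x = y\<close> by (simp add: norm_dist_def)
  qed
  assume z: "z \<in> chanturia g"
  have "enn2real (phi_var g (\<lambda>t\<in>{0..1}. x t - z t))
      \<le> enn2real (phi_var g (\<lambda>t\<in>{0..1}. x t - y t) + phi_var g (\<lambda>t\<in>{0..1}. y t - z t))"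
    using phi_var_finite[OF g diff] x y z by (intro enn2real_mono phi_var_diff_triangle) simp
  also have "\<dots> = enn2real (phi_var g (\<lambda>t\<in>{0..1}. x t - y t)) + enn2real (phi_var g (\<lambda>t\<in>{0..1}. y t - z t))"
    using phi_var_finite[OF g diff] x y z by (intro enn2real_plus) auto
  finally show "norm_dist (chanturia g) (phi_norm (phi g)) x z
      \<le> norm_dist (chanturia g) (phi_norm (phi g)) x y + norm_dist (chanturia g) (phi_norm (phi g)) y z"
    using x y z by (simp add: norm_dist_def phi_norm_eq)
qed

section \<open>Exhaustive ideals as sets of vanishing density\<close>

lemma tendsto_0_ennrealI:
  assumes "\<And>e. e > 0 \<Longrightarrow> eventually (\<lambda>n. X n \<le> ennreal e) F"
  shows "(X \<longlongrightarrow> 0) F"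
proof (rule order_tendstoI)
  fix a :: ennreal assume "0 < a"
  then obtain b where b: "0 < b" "b < a" using dense by blast
  then obtain e where e: "b = ennreal e" "e > 0"
    by (cases b) (auto simp: top_unique)
  show "eventually (\<lambda>n. X n < a) F"
    using assms[OF e(2)] by eventually_elim (use e b in auto)
qed simp

text \<open>Forwards, a tail beyond \<open>N\<close> of small \<open>phi f\<close> controls the
  counts up to an error \<open>N\<close>, which is negligible against \<open>f n\<close>. Backwards,
  once the ratio stays below \<open>e\<close> from \<open>N\<close> on, removing
  \<open>{1..n'}\<close> with \<open>n' \<ge> N\<close> leaves zero counts up to \<open>n'\<close>
  and counts of at most \<open>e * f n\<close> after it. The form covers both \<open>g\<close> and
  \<open>stretched g m\<close>.\<close>

lemma Exh_phi_iff:
  assumes pos: "\<forall>n\<ge>1. f n > 0" and lim: "filterlim f at_top sequentially"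
  shows "C \<in> Exh (phi f) \<longleftrightarrow> C \<subseteq> {1..} \<and> (\<lambda>n. real (card (C \<inter> {1..n})) / f n) \<longlonglongrightarrow> 0"
proof -
  have "(\<lambda>n. phi f (C - {1..n})) \<longlonglongrightarrow> 0 \<longleftrightarrow> (\<lambda>n. real (card (C \<inter> {1..n})) / f n) \<longlonglongrightarrow> 0"
    (is "?L \<longleftrightarrow> ?R")
  proof
    assume L: ?L
    show ?R
    proof (rule LIMSEQ_I)
      fix e :: real assume "e > 0"
      then have "eventually (\<lambda>n. phi f (C - {1..n}) < ennreal (e / 2)) sequentially"
        using order_tendstoD(2)[OF L, of "ennreal (e / 2)"] by simp
      then obtain N where "phi f (C - {1..N}) \<le> ennreal (e / 2)"
        using eventually_happens[of _ sequentially] less_imp_le by fastforce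
      then have N: "real (card ((C - {1..N}) \<inter> {1..n})) \<le> e / 2 * f n" if "n \<ge> 1" for n
        using phi_le_iff[OF pos, of "e / 2"] \<open>e > 0\<close> that by auto
      obtain N' where N': "\<And>n. n \<ge> N' \<Longrightarrow> f n > 2 * real N / e"
        using lim by (auto simp: filterlim_at_top_dense eventually_sequentially)
      have "norm (real (card (C \<inter> {1..n})) / f n - 0) < e" if n: "n \<ge> max N' 1" for n
      proof -
        have fn: "f n > 0" "2 * real N < e * f n"
          using pos n N'[of n] \<open>e > 0\<close> by (auto simp: field_simps)
        have "card (C \<inter> {1..n}) \<le> card ({1..N} \<union> ((C - {1..N}) \<inter> {1..n}))"
          by (intro card_mono) auto
        also have "\<dots> \<le> card {1..N} + card ((C - {1..N}) \<inter> {1..n})"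
          by (rule card_Un_le)
        finally have "real (card (C \<inter> {1..n})) \<le> real N + e / 2 * f n"
          using N[of n] n by simp
        with fn show ?thesis by (simp add: field_simps)
      qed
      then show "\<exists>N. \<forall>n\<ge>N. norm (real (card (C \<inter> {1..n})) / f n - 0) < e" by blast
    qed
  next
    assume R: ?R
    show ?L
    proof (rule tendsto_0_ennrealI)
      fix e :: real assume "e > 0"
      then have "eventually (\<lambda>n. real (card (C \<inter> {1..n})) / f n < e) sequentially"
        using order_tendstoD(2)[OF R] by simp
      then obtain N where N: "\<And>n. n \<ge> N \<Longrightarrow> real (card (C \<inter> {1..n})) / f n < e"
        by (auto simp: eventually_sequentially)
      have "phi f (C - {1..n'}) \<le> ennreal e" if "n' \<ge> N" for n'
        unfolding phi_le_iff[OF pos less_imp_le[OF \<open>e > 0\<close>]]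
      proof (intro allI impI)
        fix n :: nat assume "n \<ge> 1"
        then have fn: "f n > 0" using pos by simp
        show "real (card ((C - {1..n'}) \<inter> {1..n})) \<le> e * f n"
        proof (cases "n \<le> n'")
          case True
          then have "(C - {1..n'}) \<inter> {1..n} = {}" by auto
          then show ?thesis using fn \<open>e > 0\<close> by simp
        next
          case False
          have "real (card ((C - {1..n'}) \<inter> {1..n})) \<le> real (card (C \<inter> {1..n}))"
            by (intro of_nat_mono card_mono) auto
          also have "\<dots> \<le> e * f n"
            using N[of n] False that fn by (simp add: field_simps)
          finally show ?thesis .
        qed
      qed
      then show "eventually (\<lambda>n. phi f (C - {1..n}) \<le> ennreal e) sequentially"
        by (auto simp: eventually_sequentially)
    qed
  qed
  then show ?thesis by (simp add: Exh_def)
qed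

section \<open>Stretched growth functions and the inclusion of ideals\<close>

lemma increasing_seqD:
  assumes "increasing_seq m"
  shows "1 \<le> i \<Longrightarrow> i < j \<Longrightarrow> m i < m j" and "1 \<le> i \<Longrightarrow> i \<le> m i"
proof -
  show less: "m i < m j" if "1 \<le> i" "i < j" for i j
    using assms that by (auto simp: increasing_seq_def strict_mono_on_def)
  show "i \<le> m i" if "1 \<le> i"
    using that
  proof (induction i rule: nat_induct_at_least)
    case base
    then show ?case using assms by (auto simp: increasing_seq_def)
  next
    case (Suc i)
    then show ?case using less[of i "Suc i"] by simp
  qed
qed

lemma stretched_eq:
  assumes m: "increasing_seq m" and k: "1 \<le> k" "m k \<le> n" "n < m (k + 1)"
  shows "stretched g m n = real k * g n"
proof -
  have mono: "m i \<le> m j" if "1 \<le> i" "i \<le> j" for i j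
    using increasing_seqD(1)[OF m that(1), of j] that by (cases "i = j") auto
  have "(THE k. 1 \<le> k \<and> m k \<le> n \<and> n < m (k + 1)) = k"
  proof (rule the_equality)
    fix l assume l: "1 \<le> l \<and> m l \<le> n \<and> n < m (l + 1)"
    have "\<not> l < k" using mono[of "l + 1" k] l k by auto
    moreover have "\<not> k < l" using mono[of "k + 1" l] l k by auto
    ultimately show "l = k" by simp
  qed (use k in simp)
  moreover have "\<not> n < m 1" using mono[of 1 k] k by simp
  ultimately show ?thesis by (simp add: stretched_def)
qed

lemma stretched_eq_mult:
  assumes m: "increasing_seq m" and j: "1 \<le> j" "m j \<le> n"
  obtains k where "j \<le> k" "m k \<le> n" "stretched g m n = real k * g n"
proof -
  \<comment> \<open>Since \<open>k \<le> m k\<close>, the bound \<open>k \<le> n\<close> excludes no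
    index with \<open>m k \<le> n\<close>; it makes \<open>K\<close> finite, and its maximum is the
    index of the block containing \<open>n\<close>.\<close>
  define K where "K = {k \<in> {1..n}. m k \<le> n}"
  have K_iff: "k \<in> K \<longleftrightarrow> 1 \<le> k \<and> m k \<le> n" for k
    using increasing_seqD(2)[OF m, of k] by (auto simp: K_def)
  have fin: "finite K" by (simp add: K_def)
  have "j \<in> K" using j K_iff by simp
  define k where "k = Max K"
  have "k \<in> K" unfolding k_def using fin \<open>j \<in> K\<close> by (intro Max_in) auto
  then have k: "1 \<le> k" "m k \<le> n" using K_iff by auto
  have "j \<le> k" unfolding k_def using fin \<open>j \<in> K\<close> by (rule Max_ge)
  moreover have "k + 1 \<notin> K"
    using Max_ge[OF fin, of "k + 1"] by (auto simp: k_def)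
  then have "n < m (k + 1)" using K_iff[of "k + 1"] by auto
  ultimately show thesis
    using that[of k] k stretched_eq[OF m k, of g] by blast
qed

lemma stretched_ge:
  assumes g: "g \<in> growth_funs" and m: "increasing_seq m" and n: "n \<ge> 1"
  shows "g n \<le> stretched g m n"
proof (cases "n < m 1")
  case False
  then obtain k where "1 \<le> k" "stretched g m n = real k * g n"
    using stretched_eq_mult[OF m, of 1 n g] by auto
  then show ?thesis using growth_pos[OF g n] by simp
qed (simp add: stretched_def)

lemma Exh_stretched_iff:
  assumes g: "g \<in> growth_funs" and m: "increasing_seq m"
  shows "C \<in> Exh (phi (stretched g m)) \<longleftrightarrow>
    C \<subseteq> {1..} \<and> (\<lambda>n. real (card (C \<inter> {1..n})) / stretched g m n) \<longlonglongrightarrow> 0"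
proof (rule Exh_phi_iff)
  show "\<forall>n\<ge>1. 0 < stretched g m n"
    using stretched_ge[OF g m] growth_pos[OF g] by (auto intro: order_less_le_trans)
  show "filterlim (stretched g m) at_top sequentially"
    using growth_at_top[OF g] eventually_ge_at_top[of 1]
    by (rule filterlim_at_top_mono[OF _ eventually_mono]) (rule stretched_ge[OF g m])
qed

lemma Exh_growth_iff:
  assumes "g \<in> growth_funs"
  shows "C \<in> Exh (phi g) \<longleftrightarrow> C \<subseteq> {1..} \<and> (\<lambda>n. real (card (C \<inter> {1..n})) / g n) \<longlonglongrightarrow> 0"
  using growth_pos[OF assms] growth_at_top[OF assms] by (intro Exh_phi_iff) auto

text \<open>If \<open>m k\<close> lies beyond the point from which \<open>k * g n \<le> h n\<close>
  holds, then \<open>stretched g m \<le> h\<close> from \<open>m 1\<close> on, and vanishing density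
  for the smaller function implies it for \<open>h\<close>.\<close>

lemma Exh_stretched_subset:
  assumes g: "g \<in> growth_funs" and h: "h \<in> growth_funs" and lim: "(\<lambda>n. g n / h n) \<longlonglongrightarrow> 0"
  shows "\<exists>m. increasing_seq m \<and> Exh (phi (stretched g m)) \<subseteq> Exh (phi h)"
proof -
  have "\<exists>N. \<forall>n\<ge>N. n \<ge> 1 \<longrightarrow> real k * g n \<le> h n" for k
  proof -
    have "(\<lambda>n. real k * (g n / h n)) \<longlonglongrightarrow> real k * 0"
      by (intro tendsto_intros lim)
    then have "eventually (\<lambda>n. real k * (g n / h n) < 1) sequentially"
      by (intro order_tendstoD) auto
    then obtain N where "\<And>n. n \<ge> N \<Longrightarrow> real k * (g n / h n) < 1"
      by (auto simp: eventually_sequentially)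
    then have "real k * g n \<le> h n" if "n \<ge> N" "n \<ge> 1" for n
      using growth_pos[OF h that(2)] that(1) by (force simp: field_simps)
    then show ?thesis by blast
  qed
  then obtain N where N: "\<And>k n. n \<ge> N k \<Longrightarrow> n \<ge> 1 \<Longrightarrow> real k * g n \<le> h n" by metis
  \<comment> \<open>The summand \<open>k\<close> makes \<open>m\<close> positive and strictly
    increasing on \<open>{1..}\<close>; the sum ensures \<open>N k \<le> m k\<close>.\<close>
  define m where "m k = k + (\<Sum>i\<le>k. N i)" for k
  have N_le: "N k \<le> m k" for k
    by (simp add: m_def member_le_sum trans_le_add2)
  have m: "increasing_seq m"
    unfolding increasing_seq_def
    by (auto simp: m_def strict_mono_on_def intro!: add_less_le_mono sum_mono2)
  have "C \<in> Exh (phi h)" if C: "C \<in> Exh (phi (stretched g m))" for C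
  proof -
    have "eventually (\<lambda>n. norm (real (card (C \<inter> {1..n})) / h n) \<le> real (card (C \<inter> {1..n})) / stretched g m n) sequentially"
      using eventually_ge_at_top[of "m 1"]
    proof eventually_elim
      case (elim n)
      have n: "n \<ge> 1" using elim increasing_seqD(2)[OF m, of 1] by simp
      from elim obtain k where k: "m k \<le> n" "stretched g m n = real k * g n"
        using stretched_eq_mult[OF m, of 1 n g] by auto
      have "stretched g m n \<le> h n"
        using N[of k n] N_le[of k] k n by simp
      moreover have "0 < stretched g m n"
        using stretched_ge[OF g m n] growth_pos[OF g n] by simp
      ultimately show ?case
        by (auto intro!: divide_left_mono)
    qed
    moreover have "C \<subseteq> {1..}" "(\<lambda>n. real (card (C \<inter> {1..n})) / stretched g m n) \<longlonglongrightarrow> 0"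
      using C by (auto simp: Exh_stretched_iff[OF g m])
    ultimately show ?thesis
      by (auto simp: Exh_growth_iff[OF h] intro: Lim_null_comparison)
  qed
  with m show ?thesis by blast
qed

text \<open>
  Since \<open>n / g n\<close> is nondecreasing, \<open>g n / g 1\<close> grows by at most \<open>1\<close> at each step, so it is, up to
  rounding, the counting function of a set.
\<close>

lemma growth_counting_set:
  assumes g: "g \<in> growth_funs"
  obtains C where "C \<subseteq> {1..}" "\<And>n. n \<ge> 1 \<Longrightarrow> card (C \<inter> {1..n}) = nat \<lfloor>g n / g 1\<rfloor>"
proof -
  note pos = growth_pos[OF g]
  \<comment> \<open>The count at 0 is set to 0 independently of \<open>g 0\<close>. Since
    \<open>F 1 = 1\<close>, the first step also has size at most 1.\<close>
  define F where "F n = (if n = 0 then 0 else nat \<lfloor>g n / g 1\<rfloor>)" for n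
  define C where "C = {n. n \<ge> 1 \<and> F (n - 1) < F n}"
  have step: "F n \<le> F (Suc n) \<and> F (Suc n) \<le> F n + 1" for n
  proof (cases "n = 0")
    case True
    then show ?thesis using pos[of 1] by (simp add: F_def)
  next
    case False
    then have n: "n \<ge> 1" by simp
    \<comment> \<open>Monotonicity of \<open>n / g n\<close> is used twice: the increment of
      \<open>g\<close> at \<open>n\<close> is at most \<open>g n / n\<close>, which is at most
      \<open>g 1\<close>.\<close>
    have "g n / real n \<le> g 1"
      using growth_ratio_mono[OF g, of 1 n] pos[of 1] pos[OF n] n by (simp add: field_simps)
    moreover have "g (Suc n) \<le> g n + g n / real n"
      using growth_ratio_mono[OF g, of n "Suc n"] pos[of "Suc n"] pos[OF n] n by (simp add: field_simps)
    ultimately have "g (Suc n) / g 1 \<le> g n / g 1 + 1"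
      using pos[of 1] by (simp add: field_simps)
    moreover have "g n / g 1 \<le> g (Suc n) / g 1"
      using growth_mono[OF g n, of "Suc n"] pos[of 1] by (simp add: divide_right_mono)
    moreover have "0 \<le> g n / g 1" using pos[of 1] pos[OF n] by simp
    ultimately show ?thesis using False unfolding F_def by (simp, linarith)
  qed
  have "card (C \<inter> {1..n}) = F n" for n
  proof (induction n)
    case 0
    then show ?case by (simp add: F_def)
  next
    case (Suc n)
    have "C \<inter> {1..Suc n} = (if F n < F (Suc n) then insert (Suc n) (C \<inter> {1..n}) else C \<inter> {1..n})"
      by (auto simp: C_def le_Suc_eq)
    then show ?case using Suc step[of n] by auto
  qed
  then show thesis
    using that[of C] by (auto simp: C_def F_def)
qed

text \<open>A set whose counting function is \<open>g n / g 1\<close> up to rounding has density at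
  most \<open>1 / (k * g 1)\<close> relative to \<open>stretched g m\<close> on the
  \<open>k\<close>-th block. It therefore lies in the first ideal, and its membership in the second
  says that \<open>g = o(h)\<close>.\<close>

lemma tendsto_0_of_Exh_subset:
  assumes g: "g \<in> growth_funs" and h: "h \<in> growth_funs"
    and m: "increasing_seq m" and sub: "Exh (phi (stretched g m)) \<subseteq> Exh (phi h)"
  shows "(\<lambda>n. g n / h n) \<longlonglongrightarrow> 0"
proof -
  note g1 = growth_pos[OF g, of 1, simplified]
  obtain C where C: "C \<subseteq> {1..}" and card: "\<And>n. n \<ge> 1 \<Longrightarrow> card (C \<inter> {1..n}) = nat \<lfloor>g n / g 1\<rfloor>"
    using growth_counting_set[OF g] by blast
  have card_bounds: "real (card (C \<inter> {1..n})) \<le> g n / g 1" "g n / g 1 \<le> real (card (C \<inter> {1..n})) + 1"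
    if "n \<ge> 1" for n
    using card[OF that] growth_pos[OF g that] growth_pos[OF g, of 1] by (auto simp: le_nat_iff of_nat_nat)
  have "(\<lambda>n. real (card (C \<inter> {1..n})) / stretched g m n) \<longlonglongrightarrow> 0"
  proof (rule LIMSEQ_I)
    fix e :: real assume "e > 0"
    \<comment> \<open>From \<open>m j\<close> on the stretching factor is at least \<open>j\<close>,
      so the ratio is at most \<open>1 / (j * g 1) < e\<close>.\<close>
    obtain j where j: "real j > 1 / (e * g 1)" using reals_Archimedean2 by blast
    have "0 < 1 / (e * g 1)" using \<open>e > 0\<close> g1 by simp
    then have j1: "j \<ge> 1" using j by (cases j) auto
    have "norm (real (card (C \<inter> {1..n})) / stretched g m n - 0) < e" if n: "n \<ge> m j" for n
    proof -
      have n1: "n \<ge> 1" using n j1 increasing_seqD(2)[OF m j1] by simp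
      obtain k where k: "j \<le> k" "stretched g m n = real k * g n"
        using stretched_eq_mult[OF m j1 n] by metis
      have gn: "g n > 0" using growth_pos[OF g n1] .
      have "1 / (e * g 1) < real k" using j k(1) by simp
      then have "1 / (real k * g 1) < e"
        using \<open>e > 0\<close> g1 j1 k(1) by (simp add: field_simps)
      moreover have "real (card (C \<inter> {1..n})) / (real k * g n) \<le> (g n / g 1) / (real k * g n)"
        using gn card_bounds(1)[OF n1] by (intro divide_right_mono) auto
      moreover have "(g n / g 1) / (real k * g n) = 1 / (real k * g 1)"
        using gn by simp
      ultimately have "real (card (C \<inter> {1..n})) / (real k * g n) < e" by linarith
      then show ?thesis using gn k by simp
    qed
    then show "\<exists>N. \<forall>n\<ge>N. norm (real (card (C \<inter> {1..n})) / stretched g m n - 0) < e" by blast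
  qed
  then have "C \<in> Exh (phi h)"
    using C sub by (auto simp: Exh_stretched_iff[OF g m])
  then have "(\<lambda>n. real (card (C \<inter> {1..n})) / h n) \<longlonglongrightarrow> 0"
    by (simp add: Exh_growth_iff[OF h])
  \<comment> \<open>This absorbs the error of at most 1 made by rounding \<open>g n / g 1\<close>
    down.\<close>
  moreover have "(\<lambda>n. 1 / h n) \<longlonglongrightarrow> 0"
    using growth_at_top[OF h] by (intro tendsto_divide_0[OF tendsto_const] filterlim_at_top_imp_at_infinity)
  ultimately have "(\<lambda>n. g 1 * (real (card (C \<inter> {1..n})) / h n + 1 / h n)) \<longlonglongrightarrow> g 1 * (0 + 0)"
    by (intro tendsto_intros)
  then have lim: "(\<lambda>n. g 1 * (real (card (C \<inter> {1..n})) / h n + 1 / h n)) \<longlonglongrightarrow> 0" by simp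
  show ?thesis
  proof (rule Lim_null_comparison[OF _ lim])
    show "\<forall>\<^sub>F n in sequentially. norm (g n / h n) \<le> g 1 * (real (card (C \<inter> {1..n})) / h n + 1 / h n)"
      using eventually_ge_at_top[of 1]
    proof eventually_elim
      case (elim n)
      have "g n \<le> g 1 * (real (card (C \<inter> {1..n})) + 1)"
        using card_bounds(2)[OF elim] g1 by (simp add: field_simps)
      then show ?case
        using growth_pos[OF h elim] growth_pos[OF g elim] by (simp add: field_simps)
    qed
  qed
qed

section \<open>The metric of the supremum norm\<close>

lemma abs_le_sup_norm:
  assumes "x \<in> bounded_funs" and "t \<in> {0..1}"
  shows "\<bar>x t\<bar> \<le> sup_norm x"
proof -
  obtain b where "\<forall>t\<in>{0..1}. \<bar>x t\<bar> \<le> b"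
    using assms(1) by (auto simp: bounded_funs_def bounded_iff)
  then have "bdd_above ((\<lambda>t. \<bar>x t\<bar>) ` {0..1})" by (auto intro: bdd_aboveI)
  then show ?thesis
    unfolding sup_norm_def using assms(2) by (intro cSUP_upper)
qed

lemma sup_norm_le: "(\<And>t. t \<in> {0..1} \<Longrightarrow> \<bar>x t\<bar> \<le> c) \<Longrightarrow> sup_norm x \<le> c"
  unfolding sup_norm_def by (intro cSUP_least) auto

lemma bounded_funs_diff:
  assumes "x \<in> bounded_funs" and "y \<in> bounded_funs"
  shows "(\<lambda>t\<in>{0..1}. x t - y t) \<in> bounded_funs"
proof -
  have "bounded ((\<lambda>t. x t - y t) ` {0..1})"
    using assms by (intro bounded_minus_comp) (auto simp: bounded_funs_def)
  then show ?thesis by (simp add: bounded_funs_def)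
qed

lemma abs_diff_le_sup_dist:
  assumes "x \<in> bounded_funs" and "y \<in> bounded_funs" and "t \<in> {0..1}"
  shows "\<bar>x t - y t\<bar> \<le> norm_dist bounded_funs sup_norm x y"
  using abs_le_sup_norm[OF bounded_funs_diff[OF assms(1,2)] assms(3)] assms
  by (simp add: norm_dist_def)

lemma sup_dist_le:
  assumes "c \<ge> 0" and "\<And>t. t \<in> {0..1} \<Longrightarrow> \<bar>x t - y t\<bar> \<le> c"
  shows "norm_dist bounded_funs sup_norm x y \<le> c"
  using assms sup_norm_le[of "\<lambda>t\<in>{0..1}. x t - y t" c] by (simp add: norm_dist_def)

lemma Metric_space_bounded_funs: "Metric_space bounded_funs (norm_dist bounded_funs sup_norm)"
proof
  let ?d = "norm_dist bounded_funs sup_norm"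
  fix x y z :: "real \<Rightarrow> real"
  show nonneg: "0 \<le> ?d x y" for x y
  proof (cases "x \<in> bounded_funs \<and> y \<in> bounded_funs")
    case True
    then show ?thesis using abs_diff_le_sup_dist[of x y 0] by (auto intro: order_trans[OF abs_ge_zero])
  qed (auto simp: norm_dist_def)
  have "?d x y \<le> ?d y x" for x y
  proof (cases "x \<in> bounded_funs \<and> y \<in> bounded_funs")
    case True
    then show ?thesis
      using abs_diff_le_sup_dist[of y x] nonneg[of y x]
      by (intro sup_dist_le) (auto simp: abs_minus_commute)
  qed (auto simp: norm_dist_def)
  then show "?d x y = ?d y x" by (meson order_antisym)
  assume x: "x \<in> bounded_funs" and y: "y \<in> bounded_funs"
  show "?d x y = 0 \<longleftrightarrow> x = y"
  proof
    assume "?d x y = 0"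
    then have "x t = y t" if "t \<in> {0..1}" for t
      using abs_diff_le_sup_dist[OF x y that] by simp
    then show "x = y"
      using x y by (intro extensionalityI[of _ "{0..1}"]) (auto simp: bounded_funs_def)
  next
    assume "x = y"
    then show "?d x y = 0"
      using sup_dist_le[of 0 x y] nonneg[of x y] by simp
  qed
  assume z: "z \<in> bounded_funs"
  show "?d x z \<le> ?d x y + ?d y z"
  proof (rule sup_dist_le)
    show "\<bar>x t - z t\<bar> \<le> ?d x y + ?d y z" if "t \<in> {0..1}" for t
      using abs_diff_le_sup_dist[OF x y that] abs_diff_le_sup_dist[OF y z that] by simp
  qed (simp add: nonneg)
qed

section \<open>From g = o(h) to relative compactness\<close>

text \<open>In a Hausdorff space the compact set \<open>C\<close> is closed, so the closure of
  \<open>K\<close> is a closed subset of a compact set.\<close>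

lemma relatively_compact_inI:
  assumes "Hausdorff_space X" and "compactin X C" and "K \<subseteq> C"
  shows "relatively_compact_in X K"
  unfolding relatively_compact_in_def
  using assms closed_compactin[OF assms(2) closure_of_minimal closedin_closure_of]
    compactin_imp_closedin compactin_subset_topspace by (metis subset_trans)

text \<open>On a set with a common bound \<open>B\<close> in V[g(n)], small supremum norm forces
  small norm in V[h(n)]. For \<open>n \<ge> N\<close> the ratio \<open>g n / h n\<close> is small
  enough for \<open>B * g n \<le> c * h n\<close>; for \<open>n < N\<close> the sum has fewer than
  \<open>N\<close> terms of size at most \<open>2 * d\<close>.\<close>

lemma phi_norm_small:
  assumes h: "h \<in> growth_funs" and lim: "(\<lambda>n. g n / h n) \<longlonglongrightarrow> 0"
    and "B > 0" and "e > 0"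
  shows "\<exists>d>0. \<forall>z. variation_le g B z \<and> (\<forall>t\<in>{0..1}. \<bar>z t\<bar> \<le> d) \<longrightarrow> phi_norm (phi h) z \<le> e"
proof -
  \<comment> \<open>\<open>phi_norm_le\<close> gives the bound
    \<open>\<bar>z 0\<bar> + 2 * c\<close>, and each summand may take \<open>e / 2\<close>.\<close>
  define c where "c = e / 4"
  have c: "c > 0" using \<open>e > 0\<close> by (simp add: c_def)
  have h1: "h 1 > 0" using growth_pos[OF h, of 1] by simp
  have "eventually (\<lambda>n. g n / h n < c / B) sequentially"
    using lim c \<open>B > 0\<close> by (intro order_tendstoD) auto
  then obtain N where N: "\<And>n. n \<ge> N \<Longrightarrow> g n / h n < c / B"
    by (auto simp: eventually_sequentially)
  \<comment> \<open>The first entry handles \<open>\<bar>z 0\<bar>\<close>, the second yields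
    \<open>2 * N * d \<le> c * h 1\<close>; the \<open>+ 1\<close> avoids division by zero.\<close>
  define d where "d = min (e / 2) (c * h 1 / (2 * (real N + 1)))"
  have "d > 0" using c h1 \<open>e > 0\<close> by (simp add: d_def)
  have dN: "2 * real N * d \<le> c * h 1"
  proof -
    have "d \<le> c * h 1 / (2 * (real N + 1))" by (simp add: d_def)
    then have "2 * real N * d + 2 * d \<le> c * h 1" by (simp add: field_simps)
    then show ?thesis using \<open>d > 0\<close> by linarith
  qed
  have "phi_norm (phi h) z \<le> e" if z: "variation_le g B z" and zd: "\<forall>t\<in>{0..1}. \<bar>z t\<bar> \<le> d" for z
  proof -
    have incr_le: "incr z p \<le> 2 * d" if up: "p \<in> unit_subintervals" for p
    proof -
      obtain s t where p: "p = (s, t)" "s \<in> {0..1}" "t \<in> {0..1}"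
        using up by (cases p) (auto simp: unit_subintervals_def)
      then have "\<bar>z s\<bar> \<le> d" "\<bar>z t\<bar> \<le> d" using zd by blast+
      then show ?thesis by (simp add: incr_def p)
    qed
    have "variation_le h c z"
      unfolding variation_le_def
    proof (intro allI impI ballI)
      fix n :: nat and J assume n: "n \<ge> 1" and J: "J \<in> interval_seqs {1..n}"
      show "(\<Sum>k=1..n. incr z (J k)) \<le> c * h n"
      proof (cases "n \<ge> N")
        case True
        have "B * g n \<le> c * h n"
          using N[OF True] growth_pos[OF h n] \<open>B > 0\<close> by (simp add: field_simps)
        then show ?thesis using variation_leD[OF z n J] by simp
      next
        case False
        have "(\<Sum>k=1..n. incr z (J k)) \<le> (\<Sum>k=1..n. 2 * d)"
          using interval_seqsD[OF J] incr_le by (intro sum_mono) auto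
        also have "\<dots> = real n * (2 * d)" by simp
        also have "\<dots> \<le> real N * (2 * d)"
          using False \<open>d > 0\<close> by (intro mult_right_mono) auto
        also have "\<dots> \<le> c * h 1" using dN by simp
        also have "\<dots> \<le> c * h n"
          using growth_mono[OF h _ n] c by (intro mult_left_mono) auto
        finally show ?thesis .
      qed
    qed
    moreover have "\<bar>z 0\<bar> \<le> e / 2" using zd by (force simp: d_def)
    ultimately show ?thesis
      using phi_norm_le[OF h c, of z] by (simp add: c_def)
  qed
  with \<open>d > 0\<close> show ?thesis by blast
qed

text \<open>For fixed \<open>n\<close>, a uniform error \<open>e / (2 * n)\<close> changes the sum
  of \<open>n\<close> increments by at most \<open>e\<close>. This carries the variation bound from
  \<open>K\<close> to its closure in the supremum norm.\<close>

lemma variation_le_closure: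
  assumes x: "\<And>e. e > 0 \<Longrightarrow> \<exists>x. variation_le g B x \<and> (\<forall>t\<in>{0..1}. \<bar>x t - z t\<bar> \<le> e)"
  shows "variation_le g B z"
  unfolding variation_le_def
proof (intro allI impI ballI)
  fix n :: nat and J assume n: "n \<ge> 1" and J: "J \<in> interval_seqs {1..n}"
  show "(\<Sum>k=1..n. incr z (J k)) \<le> B * g n"
  proof (rule field_le_epsilon)
    fix e :: real assume "e > 0"
    obtain x where x: "variation_le g B x" and xz: "\<forall>t\<in>{0..1}. \<bar>x t - z t\<bar> \<le> e / (2 * real n)"
      using x[of "e / (2 * real n)"] \<open>e > 0\<close> n by auto
    have incr_le: "incr z p \<le> incr x p + e / real n" if up: "p \<in> unit_subintervals" for p
    proof -
      obtain s t where p: "p = (s, t)" "s \<in> {0..1}" "t \<in> {0..1}"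
        using up by (cases p) (auto simp: unit_subintervals_def)
      then have "\<bar>x s - z s\<bar> \<le> e / (2 * real n)" "\<bar>x t - z t\<bar> \<le> e / (2 * real n)"
        using xz by blast+
      moreover have "e / real n = e / (2 * real n) + e / (2 * real n)"
        using n by (simp add: field_simps)
      ultimately show ?thesis by (simp add: incr_def p)
    qed
    have "(\<Sum>k=1..n. incr z (J k)) \<le> (\<Sum>k=1..n. incr x (J k) + e / real n)"
      using interval_seqsD[OF J] incr_le by (intro sum_mono) auto
    also have "\<dots> \<le> B * g n + e"
      using variation_leD[OF x n J] n by (simp add: sum.distrib)
    finally show "(\<Sum>k=1..n. incr z (J k)) \<le> B * g n + e" .
  qed
qed

text \<open>The closure \<open>C\<close> of \<open>K\<close> in the supremum norm is compact and
  inherits the variation bound. A uniformly convergent subsequence in \<open>C\<close> has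
  differences from its limit bounded in V[g(n)], so by \<open>phi_norm_small\<close> it converges in
  V[h(n)]. Thus \<open>C\<close> is compact there too.\<close>

lemma relatively_compact_chanturia:
  assumes g: "g \<in> growth_funs" and h: "h \<in> growth_funs" and lim: "(\<lambda>n. g n / h n) \<longlonglongrightarrow> 0"
    and K: "K \<subseteq> chanturia g" and B: "\<And>x. x \<in> K \<Longrightarrow> phi_norm (phi g) x \<le> B"
    and rc: "relatively_compact_in (norm_topology bounded_funs sup_norm) K"
  shows "K \<subseteq> chanturia h \<and> relatively_compact_in (norm_topology (chanturia h) (phi_norm (phi h))) K"
proof -
  interpret S: Metric_space bounded_funs "norm_dist bounded_funs sup_norm"
    by (rule Metric_space_bounded_funs)
  interpret H: Metric_space "chanturia h" "norm_dist (chanturia h) (phi_norm (phi h))"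
    by (rule Metric_space_chanturia[OF h])
  define C where "C = S.mtopology closure_of K"
  have K_sub: "K \<subseteq> bounded_funs" and C: "compactin S.mtopology C"
    using rc by (auto simp: relatively_compact_in_def norm_topology_def C_def)
  have KC: "K \<subseteq> C"
    unfolding C_def using K_sub by (intro closure_of_subset) simp
  have C_sub: "C \<subseteq> bounded_funs"
    using compactin_subset_topspace[OF C] by simp
  \<comment> \<open>\<open>B\<close> need not be positive, for instance when \<open>K\<close> is
    empty; the later estimates use a positive bound.\<close>
  define B' where "B' = max B 1"
  have B': "B' > 0" by (simp add: B'_def)
  have K_var: "variation_le g B' x" if "x \<in> K" for x
    using variation_le_phi_norm[OF g, of x B'] K B[OF that] that by (auto simp: B'_def)
  have C_var: "variation_le g B' z" if zC: "z \<in> C" for z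
  proof (rule variation_le_closure)
    fix e :: real assume "e > 0"
    then obtain x where x: "x \<in> K" "x \<in> S.mball z e"
      using zC unfolding C_def S.metric_closure_of by blast
    then have "norm_dist bounded_funs sup_norm z x < e" "z \<in> bounded_funs" "x \<in> bounded_funs"
      by auto
    then have "\<forall>t\<in>{0..1}. \<bar>x t - z t\<bar> \<le> e"
      using abs_diff_le_sup_dist[of z x] by (force simp: abs_minus_commute)
    then show "\<exists>x. variation_le g B' x \<and> (\<forall>t\<in>{0..1}. \<bar>x t - z t\<bar> \<le> e)"
      using K_var x by blast
  qed
  obtain b where b: "b > 0" "\<And>n. norm (g n / h n) \<le> b"
    using convergent_imp_Bseq[OF convergentI[OF lim]] by (auto simp: Bseq_def)
  have gh: "g n \<le> b * h n" if "n \<ge> 1" for n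
    using b(2)[of n] growth_pos[OF g that] growth_pos[OF h that] by (simp add: field_simps)
  have C_h: "C \<subseteq> chanturia h"
  proof
    fix z assume "z \<in> C"
    have "variation_le h (B' * b) z"
      using C_var[OF \<open>z \<in> C\<close>] by (rule variation_le_mono) (use gh B' in \<open>simp add: mult.assoc\<close>)
    then show "z \<in> chanturia h"
      unfolding chanturia_iff[OF h] using C_sub \<open>z \<in> C\<close> B' b(1)
      by (auto simp: bounded_funs_def intro!: exI[of _ "B' * b"])
  qed
  have "compactin H.mtopology C"
    unfolding H.compactin_sequentially
  proof (intro conjI allI impI C_h)
    fix \<sigma> :: "nat \<Rightarrow> real \<Rightarrow> real" assume \<sigma>: "range \<sigma> \<subseteq> C"
    then obtain l r where l: "l \<in> C" and r: "strict_mono r"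
      and lim: "limitin S.mtopology (\<sigma> \<circ> r) l sequentially"
      using C unfolding S.compactin_sequentially by blast
    have "limitin H.mtopology (\<sigma> \<circ> r) l sequentially"
      unfolding H.limit_metric_sequentially
    proof (intro conjI allI impI)
      show "l \<in> chanturia h" using l C_h by blast
      fix e :: real assume "e > 0"
      then obtain d where d: "d > 0"
        "\<And>z. variation_le g (B' + B') z \<Longrightarrow> (\<forall>t\<in>{0..1}. \<bar>z t\<bar> \<le> d) \<Longrightarrow> phi_norm (phi h) z \<le> e / 2"
        using phi_norm_small[OF h \<open>(\<lambda>n. g n / h n) \<longlonglongrightarrow> 0\<close>, of "B' + B'" "e / 2"] B' by auto
      obtain N where N: "\<And>n. n \<ge> N \<Longrightarrow> norm_dist bounded_funs sup_norm ((\<sigma> \<circ> r) n) l < d"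
        using lim \<open>d > 0\<close> unfolding S.limit_metric_sequentially by blast
      have "(\<sigma> \<circ> r) n \<in> chanturia h \<and> norm_dist (chanturia h) (phi_norm (phi h)) ((\<sigma> \<circ> r) n) l < e"
        if "n \<ge> N" for n
      proof -
        have mem: "(\<sigma> \<circ> r) n \<in> C" using \<sigma> by auto
        have "\<forall>t\<in>{0..1}. \<bar>(\<lambda>t\<in>{0..1}. (\<sigma> \<circ> r) n t - l t) t\<bar> \<le> d"
        proof
          fix t :: real assume t: "t \<in> {0..1}"
          show "\<bar>(\<lambda>t\<in>{0..1}. (\<sigma> \<circ> r) n t - l t) t\<bar> \<le> d"
            using abs_diff_le_sup_dist[of "(\<sigma> \<circ> r) n" l, OF _ _ t] N[OF that] mem l C_sub t by fastforce
        qed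
        then have "phi_norm (phi h) (\<lambda>t\<in>{0..1}. (\<sigma> \<circ> r) n t - l t) \<le> e / 2"
          by (intro d(2) variation_le_diff C_var mem l)
        then show ?thesis
          using mem l C_h \<open>e > 0\<close> by (auto simp: norm_dist_def)
      qed
      then show "\<exists>N. \<forall>n\<ge>N. (\<sigma> \<circ> r) n \<in> chanturia h \<and>
          norm_dist (chanturia h) (phi_norm (phi h)) ((\<sigma> \<circ> r) n) l < e" by blast
    qed
    then show "\<exists>l r. l \<in> C \<and> strict_mono r \<and> limitin H.mtopology (\<sigma> \<circ> r) l sequentially"
      using l r by blast
  qed
  then have "relatively_compact_in H.mtopology K"
    using KC by (intro relatively_compact_inI[OF H.Hausdorff_space_mtopology])
  then show ?thesis
    using KC C_h by (auto simp: norm_topology_def)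
qed

section \<open>Oscillating functions and the necessity of g = o(h)\<close>

text \<open>The open interiors are disjoint subsets of the unit interval, so their Lebesgue measures
  add up to at most 1.\<close>

lemma sum_lengths_le:
  assumes J: "J \<in> interval_seqs {1..n}"
  shows "(\<Sum>k=1..n. snd (J k) - fst (J k)) \<le> 1"
proof -
  define A where "A k = {fst (J k)<..<snd (J k)}" for k
  have le: "0 \<le> fst (J k)" "fst (J k) \<le> snd (J k)" "snd (J k) \<le> 1" if "k \<in> {1..n}" for k
    using interval_seqsD[OF J that] by (auto simp: unit_subintervals_def)
  have "disjoint_family_on A {1..n}"
    using J unfolding interval_seqs_def nonoverlapping_def disjoint_family_on_def pairwise_def disjnt_def A_def
    by (simp add: interior_atLeastAtMost_real del: atLeastAtMost_iff)
  then have "measure lborel (\<Union>k\<in>{1..n}. A k) = (\<Sum>k=1..n. measure lborel (A k))"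
  proof (intro measure_finite_Union)
    show "emeasure lborel (A k) \<noteq> \<infinity>" if "k \<in> {1..n}" for k
      using le[OF that] by (simp add: A_def)
    show "A ` {1..n} \<subseteq> sets lborel" by (auto simp: A_def)
  qed simp
  also have "\<dots> = (\<Sum>k=1..n. snd (J k) - fst (J k))"
    using le by (intro sum.cong refl) (auto simp: A_def)
  finally have "(\<Sum>k=1..n. snd (J k) - fst (J k)) = measure lborel (\<Union>k\<in>{1..n}. A k)" by simp
  also have "\<dots> \<le> measure lborel {0..1::real}"
  proof (intro measure_mono_fmeasurable)
    have "A k \<subseteq> {0..1}" if "k \<in> {1..n}" for k
      using le[OF that] by (auto simp: A_def)
    then show "(\<Union>k\<in>{1..n}. A k) \<subseteq> {0..1}" by blast
  qed (auto simp: A_def fmeasurable_def)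
  finally show ?thesis by simp
qed

text \<open>\<open>N\<close> half-waves of amplitude \<open>a\<close>, with extrema exactly at the
  multiples of \<open>1 / N\<close> when \<open>a\<close> and \<open>N\<close> are nonzero.\<close>

definition osc :: "nat \<Rightarrow> real \<Rightarrow> real \<Rightarrow> real" where
  "osc N a = (\<lambda>t\<in>{0..1}. a * cos (pi * real N * t))"

lemma abs_cos_diff_le: "\<bar>cos a - cos b\<bar> \<le> \<bar>a - b\<bar>" for a b :: real
proof -
  have "\<bar>cos a - cos b\<bar> = 2 * \<bar>sin ((a + b) / 2)\<bar> * \<bar>sin ((b - a) / 2)\<bar>"
    by (simp add: cos_diff_cos abs_mult)
  also have "\<dots> \<le> 2 * 1 * \<bar>(b - a) / 2\<bar>"
    by (intro mult_mono abs_sin_x_le_abs_x) auto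
  finally show ?thesis by simp
qed

lemma abs_osc_le: "a \<ge> 0 \<Longrightarrow> t \<in> {0..1} \<Longrightarrow> \<bar>osc N a t\<bar> \<le> a"
  by (simp add: osc_def abs_mult mult_left_le)

text \<open>For \<open>n \<le> N\<close> each increment is at most \<open>2 * a\<close>, and
  \<open>a * n \<le> g n\<close> because \<open>n / g n\<close> is nondecreasing. For
  \<open>n > N\<close> the Lipschitz constant \<open>pi * a * N\<close> bounds the whole sum by
  \<open>pi * g N\<close>, which is at most \<open>4 * g n\<close>.\<close>

lemma variation_le_osc:
  assumes g: "g \<in> growth_funs" and N: "N \<ge> 1" and a: "0 \<le> a" "a * real N \<le> g N"
  shows "variation_le g 4 (osc N a)"
  unfolding variation_le_def
proof (intro allI impI ballI)
  fix n :: nat and J assume n: "n \<ge> 1" and J: "J \<in> interval_seqs {1..n}"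
  have ends: "fst (J k) \<in> {0..1}" "snd (J k) \<in> {0..1}" "fst (J k) \<le> snd (J k)" if "k \<in> {1..n}" for k
    using interval_seqsD[OF J that] by (auto simp: unit_subintervals_def)
  have incr_eq: "incr (osc N a) (J k) = \<bar>osc N a (snd (J k)) - osc N a (fst (J k))\<bar>" for k
    by (simp add: incr_def split: prod.split)
  show "(\<Sum>k=1..n. incr (osc N a) (J k)) \<le> 4 * g n"
  proof (cases "n \<le> N")
    case True
    have "incr (osc N a) (J k) \<le> 2 * a" if "k \<in> {1..n}" for k
      using abs_osc_le[OF a(1) ends(1)[OF that], of N] abs_osc_le[OF a(1) ends(2)[OF that], of N]
      by (simp add: incr_eq)
    then have "(\<Sum>k=1..n. incr (osc N a) (J k)) \<le> (\<Sum>k=1..n. 2 * a)"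
      by (intro sum_mono)
    also have "\<dots> = 2 * (a * real n)" by simp
    also have "a * real n \<le> g n"
    proof -
      have "a \<le> g N / real N" using a N by (simp add: field_simps)
      also have "\<dots> \<le> g n / real n"
        using growth_ratio_mono[OF g n True] growth_pos[OF g n] growth_pos[OF g N] n N
        by (simp add: field_simps)
      finally show ?thesis using n by (simp add: field_simps)
    qed
    finally show ?thesis using growth_pos[OF g n] by simp
  next
    case False
    have "incr (osc N a) (J k) \<le> a * pi * real N * (snd (J k) - fst (J k))" if k: "k \<in> {1..n}" for k
    proof -
      have "incr (osc N a) (J k) = a * \<bar>cos (pi * real N * snd (J k)) - cos (pi * real N * fst (J k))\<bar>"
        unfolding incr_eq using ends[OF k] a(1) by (simp add: osc_def right_diff_distrib[symmetric] abs_mult)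
      also have "\<dots> \<le> a * \<bar>pi * real N * snd (J k) - pi * real N * fst (J k)\<bar>"
        using a(1) by (intro mult_left_mono abs_cos_diff_le)
      also have "\<dots> = a * pi * real N * (snd (J k) - fst (J k))"
        using ends(3)[OF k] by (simp add: right_diff_distrib[symmetric] abs_mult)
      finally show ?thesis .
    qed
    then have "(\<Sum>k=1..n. incr (osc N a) (J k)) \<le> (\<Sum>k=1..n. a * pi * real N * (snd (J k) - fst (J k)))"
      by (intro sum_mono)
    also have "\<dots> = a * pi * real N * (\<Sum>k=1..n. snd (J k) - fst (J k))"
      by (simp add: sum_distrib_left)
    also have "\<dots> \<le> a * pi * real N * 1"
      using a(1) by (intro mult_left_mono sum_lengths_le[OF J]) auto
    also have "\<dots> = pi * (a * real N)" by simp
    also have "\<dots> \<le> 4 * g n"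
      using pi_less_4 a growth_mono[OF g N, of n] False by (intro mult_mono) auto
    finally show ?thesis .
  qed
qed

text \<open>Each of the \<open>N\<close> intervals of length \<open>1 / N\<close> carries one
  half-wave from one extremum to the opposite one, contributing \<open>2 * a\<close>.\<close>

lemma osc_variation_ge:
  assumes N: "N \<ge> 1" and a: "0 \<le> a" and v: "variation_le h c (osc N a)"
  shows "2 * a * real N \<le> c * h N"
proof -
  define J where "J k = ((real k - 1) / real N, real k / real N)" for k :: nat
  have J_unit: "J k \<in> unit_subintervals" if "k \<in> {1..N}" for k
    using that N by (auto simp: J_def unit_subintervals_def field_simps)
  have disj: "disjnt (interior {fst (J i)..snd (J i)}) (interior {fst (J j)..snd (J j)})"
    if "i < j" for i j
  proof -
    have "real i / real N \<le> (real j - 1) / real N"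
      using that by (intro divide_right_mono) auto
    then show ?thesis by (auto simp: J_def disjnt_def)
  qed
  have "J \<in> interval_seqs {1..N}"
    unfolding interval_seqs_def nonoverlapping_def pairwise_def
    using J_unit disj by (auto simp: neq_iff disjnt_sym)
  from variation_leD[OF v N this] have "(\<Sum>k=1..N. incr (osc N a) (J k)) \<le> c * h N" .
  moreover have "incr (osc N a) (J k) = 2 * a" if k: "k \<in> {1..N}" for k
  proof -
    have unit: "(real k - 1) / real N \<in> {0..1}" "real k / real N \<in> {0..1}"
      using J_unit[OF k] by (auto simp: J_def unit_subintervals_def)
    obtain i where i: "k = Suc i" using k by (cases k) auto
    have "pi * real N * (real k / real N) = real (Suc i) * pi"
      "pi * real N * ((real k - 1) / real N) = real i * pi"
      using N i by auto
    then have "incr (osc N a) (J k) = \<bar>a * cos (real (Suc i) * pi) - a * cos (real i * pi)\<bar>"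
      using unit by (simp only: incr_def osc_def J_def split_conv restrict_apply if_True)
    also have "\<dots> = a * \<bar>(- 1) ^ Suc i - (- 1) ^ i\<bar>"
      using a unfolding cos_npi right_diff_distrib[symmetric] abs_mult by simp
    also have "\<dots> = 2 * a" by (cases "even i") auto
    finally show ?thesis .
  qed
  ultimately show ?thesis by (simp add: algebra_simps)
qed

text \<open>Along a subsequence with \<open>e * h n \<le> g n\<close>, the functions
  \<open>osc n (g n / n)\<close> form, together with their uniform limit 0, a set to which
  \<open>rc\<close> applies. A limit of a subsequence in V[h(n)] is 0 pointwise, yet the norms there
  are at least \<open>2 * e\<close>.\<close>

lemma tendsto_0_of_relatively_compact:
  assumes g: "g \<in> growth_funs" and h: "h \<in> growth_funs"
    and rc: "\<And>K. K \<subseteq> chanturia g \<Longrightarrow> (\<exists>B. \<forall>x\<in>K. phi_norm (phi g) x \<le> B) \<Longrightarrow>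
             relatively_compact_in (norm_topology bounded_funs sup_norm) K \<Longrightarrow>
             relatively_compact_in (norm_topology (chanturia h) (phi_norm (phi h))) K"
  shows "(\<lambda>n. g n / h n) \<longlonglongrightarrow> 0"
proof (rule ccontr)
  assume "\<not> (\<lambda>n. g n / h n) \<longlonglongrightarrow> 0"
  then obtain e where e: "e > 0" "\<And>N. \<exists>n\<ge>N. e \<le> norm (g n / h n)"
    by (auto simp: LIMSEQ_iff not_less)
  have inf: "infinite {n. n \<ge> 1 \<and> e * h n \<le> g n}"
    unfolding infinite_nat_iff_unbounded_le
  proof
    fix N
    obtain n where n: "n \<ge> max N 1" "e \<le> norm (g n / h n)" using e(2) by blast
    then have "e * h n \<le> g n"
      using growth_pos[OF g, of n] growth_pos[OF h, of n] by (simp add: field_simps)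
    then show "\<exists>n\<ge>N. n \<in> {n. n \<ge> 1 \<and> e * h n \<le> g n}" using n by auto
  qed
  obtain r :: "nat \<Rightarrow> nat" where r: "strict_mono r" "\<And>j. r j \<ge> 1" "\<And>j. e * h (r j) \<le> g (r j)"
    using infinite_enumerate[OF inf] by auto
  define a where "a j = g (r j) / real (r j)" for j
  define w where "w j = osc (r j) (a j)" for j
  \<comment> \<open>The zero function, written as an oscillation of amplitude 0 so that
    \<open>variation_le_osc\<close> covers it.\<close>
  define z where "z = osc 1 0"
  have a_pos: "0 < a j" for j using growth_pos[OF g r(2)[of j]] r(2)[of j] by (simp add: a_def)
  have a_eq: "a j * real (r j) = g (r j)" for j using r(2)[of j] by (simp add: a_def)
  have a_le: "a j \<le> g 1" for j
    using growth_ratio_mono[OF g, of 1 "r j"] growth_pos[OF g r(2), of j] growth_pos[OF g, of 1] r(2)[of j]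
    by (simp add: a_def field_simps)
  have "(\<lambda>n. inverse (real n / g n)) \<longlonglongrightarrow> 0"
    using growth_ratio_at_top[OF g] by (rule tendsto_inverse_0_at_top)
  then have a_lim: "a \<longlonglongrightarrow> 0"
    using LIMSEQ_subseq_LIMSEQ[OF _ r(1), of "\<lambda>n. inverse (real n / g n)" 0] by (simp add: a_def[abs_def] o_def)
  have w_var: "variation_le g 4 (w j)" for j
    unfolding w_def using a_pos a_eq r(2) by (intro variation_le_osc[OF g]) (auto intro: less_imp_le)
  have z_var: "variation_le g 4 z"
    unfolding z_def using growth_pos[OF g, of 1] by (intro variation_le_osc[OF g]) auto
  have w_abs: "\<bar>w j t\<bar> \<le> a j" if "t \<in> {0..1}" for j t
    unfolding w_def using a_pos that by (intro abs_osc_le) (auto intro: less_imp_le)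
  have z_0: "z t = 0" if "t \<in> {0..1}" for t
    using that by (simp add: z_def osc_def)
  have ext: "w j \<in> extensional {0..1}" "z \<in> extensional {0..1}" for j
    by (simp_all add: w_def z_def osc_def)
  have chant: "w j \<in> chanturia g" "z \<in> chanturia g" for j
    unfolding chanturia_iff[OF g] using ext w_var z_var by (auto intro!: exI[of _ 4])
  have bdd: "w j \<in> bounded_funs" "z \<in> bounded_funs" for j
  proof -
    have "\<forall>t\<in>{0..1}. norm (w j t) \<le> a j" "\<forall>t\<in>{0..1}. norm (z t) \<le> 0"
      using w_abs z_0 by auto
    then show "w j \<in> bounded_funs" "z \<in> bounded_funs"
      using ext unfolding bounded_funs_def bounded_iff by blast+
  qed
  define K where "K = insert z (range w)"
  \<comment> \<open>The value at 0 contributes at most \<open>g 1\<close>, and the variation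
    constant 4 is doubled by \<open>phi_norm_le\<close>.\<close>
  have norm_le: "phi_norm (phi g) x \<le> g 1 + 8" if "x \<in> K" for x
  proof -
    have "variation_le g 4 x" "\<bar>x 0\<bar> \<le> g 1"
      using that w_var z_var w_abs[of 0] a_le z_0[of 0] growth_pos[OF g, of 1] unfolding K_def
      by (auto intro: order_trans)
    then show ?thesis using phi_norm_le[OF g, of 4 x] by simp
  qed
  interpret S: Metric_space bounded_funs "norm_dist bounded_funs sup_norm"
    by (rule Metric_space_bounded_funs)
  interpret H: Metric_space "chanturia h" "norm_dist (chanturia h) (phi_norm (phi h))"
    by (rule Metric_space_chanturia[OF h])
  have "limitin S.mtopology w z sequentially"
    unfolding S.limitin_metric
  proof (intro conjI allI impI bdd)
    fix d :: real assume "d > 0"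
    have "norm_dist bounded_funs sup_norm (w j) z \<le> a j" for j
      using w_abs z_0 a_pos[of j] by (intro sup_dist_le) (auto intro: less_imp_le)
    then show "\<forall>\<^sub>F j in sequentially. w j \<in> bounded_funs \<and> norm_dist bounded_funs sup_norm (w j) z < d"
      using order_tendstoD(2)[OF a_lim \<open>d > 0\<close>] bdd
      by (auto elim!: eventually_mono intro: order_le_less_trans)
  qed
  then have "compactin S.mtopology K"
    unfolding K_def using bdd by (intro compactin_sequence_with_limit) auto
  then have "relatively_compact_in S.mtopology K"
    by (rule relatively_compact_inI[OF S.Hausdorff_space_mtopology _ order_refl])
  then have "relatively_compact_in H.mtopology K"
    using rc[of K] norm_le chant unfolding norm_topology_def K_def by blast
  then have K_sub: "K \<subseteq> chanturia h" and compact: "compactin H.mtopology (H.mtopology closure_of K)"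
    by (auto simp: relatively_compact_in_def)
  have "range w \<subseteq> H.mtopology closure_of K"
    using closure_of_subset[of K H.mtopology] K_sub by (auto simp: K_def)
  then obtain l s where s: "strict_mono s" and lim: "limitin H.mtopology (w \<circ> s) l sequentially"
    using compact unfolding H.compactin_sequentially by blast
  have l: "l \<in> chanturia h" using lim by (simp add: H.limitin_metric)
  have wh: "w j \<in> chanturia h" for j using K_sub by (auto simp: K_def)
  define p where "p j = phi_norm (phi h) (\<lambda>t\<in>{0..1}. w (s j) t - l t)" for j
  have p_lim: "p \<longlonglongrightarrow> 0"
  proof (rule LIMSEQ_I)
    fix d :: real assume "d > 0"
    then obtain N where "\<And>n. n \<ge> N \<Longrightarrow> norm_dist (chanturia h) (phi_norm (phi h)) (w (s n)) l < d"
      using lim unfolding H.limit_metric_sequentially o_def by blast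
    then show "\<exists>N. \<forall>n\<ge>N. norm (p n - 0) < d"
      using wh l phi_norm_nonneg by (auto simp: norm_dist_def p_def)
  qed
  have l_0: "l t = 0" if t: "t \<in> {0..1}" for t
  proof -
    have "\<bar>l t\<bar> \<le> p j * (1 + h 1) + a (s j)" for j
      using abs_le_phi_norm[OF h chanturia_diff[OF h wh l] t, of "s j"] w_abs[OF t, of "s j"] t
      by (simp add: p_def)
    moreover have "(\<lambda>j. p j * (1 + h 1) + a (s j)) \<longlonglongrightarrow> 0 * (1 + h 1) + 0"
      using LIMSEQ_subseq_LIMSEQ[OF a_lim s] by (intro tendsto_intros p_lim) (simp add: o_def)
    ultimately have "\<bar>l t\<bar> \<le> 0" by (intro LIMSEQ_le_const[of _ 0]) auto
    then show ?thesis by simp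
  qed
  have "2 * e \<le> p j" for j
  proof -
    let ?N = "r (s j)"
    \<comment> \<open>As \<open>l\<close> vanishes, \<open>p j\<close> is the norm of the
      oscillation itself, to which the lower bound \<open>2 * a * N = 2 * g N\<close>
      applies.\<close>
    have "(\<lambda>t\<in>{0..1}. w (s j) t - l t) = osc ?N (a (s j))"
      using l_0 by (auto simp: w_def osc_def restrict_def)
    then have "variation_le h (p j) (osc ?N (a (s j)))"
      using variation_le_phi_norm[OF h chanturia_diff[OF h wh[of "s j"] l] order_refl] by (simp add: p_def)
    then have "2 * a (s j) * real ?N \<le> p j * h ?N"
      using a_pos[of "s j"] by (intro osc_variation_ge r(2)) auto
    then have "2 * g ?N \<le> p j * h ?N" using a_eq[of "s j"] by simp
    with r(3)[of "s j"] have "2 * e * h ?N \<le> p j * h ?N" by simp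
    then show ?thesis using growth_pos[OF h r(2)[of "s j"]] by simp
  qed
  then have "2 * e \<le> 0" using p_lim by (intro LIMSEQ_le_const) auto
  then show False using e(1) by simp
qed

theorem theorem4p7:
  fixes g h :: "nat \<Rightarrow> real"
  assumes "g \<in> growth_funs" and "h \<in> growth_funs"
  shows "((\<forall>K. K \<subseteq> chanturia g \<and> (\<exists>B. \<forall>x\<in>K. phi_norm (phi g) x \<le> B) \<and>
             relatively_compact_in (norm_topology bounded_funs sup_norm) K \<longrightarrow>
             K \<subseteq> chanturia h \<and>
             relatively_compact_in (norm_topology (chanturia h) (phi_norm (phi h))) K)
           \<longleftrightarrow> ((\<lambda>n. g n / h n) \<longlonglongrightarrow> 0))
       \<and> (((\<lambda>n. g n / h n) \<longlonglongrightarrow> 0)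
           \<longleftrightarrow> (\<exists>m. increasing_seq m \<and> Exh (phi (stretched g m)) \<subseteq> Exh (phi h)))"
proof (intro conjI iffI)
  assume "\<forall>K. K \<subseteq> chanturia g \<and> (\<exists>B. \<forall>x\<in>K. phi_norm (phi g) x \<le> B) \<and>
             relatively_compact_in (norm_topology bounded_funs sup_norm) K \<longrightarrow>
             K \<subseteq> chanturia h \<and>
             relatively_compact_in (norm_topology (chanturia h) (phi_norm (phi h))) K"
  then show "(\<lambda>n. g n / h n) \<longlonglongrightarrow> 0"
    by (intro tendsto_0_of_relatively_compact[OF assms]) blast
next
  assume "(\<lambda>n. g n / h n) \<longlonglongrightarrow> 0"
  then show "\<forall>K. K \<subseteq> chanturia g \<and> (\<exists>B. \<forall>x\<in>K. phi_norm (phi g) x \<le> B) \<and>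
             relatively_compact_in (norm_topology bounded_funs sup_norm) K \<longrightarrow>
             K \<subseteq> chanturia h \<and>
             relatively_compact_in (norm_topology (chanturia h) (phi_norm (phi h))) K"
    using relatively_compact_chanturia[OF assms] by blast
next
  assume "(\<lambda>n. g n / h n) \<longlonglongrightarrow> 0"
  then show "\<exists>m. increasing_seq m \<and> Exh (phi (stretched g m)) \<subseteq> Exh (phi h)"
    by (rule Exh_stretched_subset[OF assms])
next
  assume "\<exists>m. increasing_seq m \<and> Exh (phi (stretched g m)) \<subseteq> Exh (phi h)"
  then show "(\<lambda>n. g n / h n) \<longlonglongrightarrow> 0"
    using tendsto_0_of_Exh_subset[OF assms] by blast
qed

end
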